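(* Given an instance of the tree knapsack problem, one can compute in polynomial time an integer (i.e. $\{0,1\}$-valued) feasible solution to the linear program (TK-P) whose objective value is at least $\mathrm{OPT}_{\mathrm{TK\text{-}P}}-\max_{\text{chains } C\subseteq N}\alpha(C)$, where $\mathrm{OPT}_{\mathrm{TK\text{-}P}}$ is the optimal value of (TK-P).
   Context: Tree knapsack: a rooted tree $\Gamma=(\{r\}\cup N,A)$ with root $r$ and non-root node set $N$; each $v\in N$ has value $\alpha_v\ge 0$ and weight $\beta_v\ge0$; there is a budget $B\ge 0$. For $S\subseteq N$ write $\alpha(S)=\sum_{v\in S}\alpha_v$. Let $\mathrm{child}(v)$ be the set of children of $v$. The LP (TK-P) is: maximize $\sum_{v\in N}\alpha_vx_v$ subject to $x_v\le x_u$ for all $v\in N$ and all $u\in\mathrm{child}(v)$, $\sum_{v\in N}\beta_vx_v\le B$, and $0\le x_v\le 1$ for all $v\in N$. A set $C\subseteq N$ is a chain if for every two distinct nodes of $C$ one is a descendant of the other. *)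

theory Defs
  imports
    Complex_Main
    "HOL-Library.Log_Nat"
    "HOL-Computational_Algebra.Polynomial"
begin

section \<open>Tree knapsack and its linear relaxation\<close>

text \<open>The data are rational because instances are the input of an algorithm;
  the linear program itself ranges over real vectors.\<close>

record 'v tree_knapsack =
  root :: 'v
  nodes :: "'v set"
  arcs :: "('v \<times> 'v) set"
  val :: "'v \<Rightarrow> rat"
  wgt :: "'v \<Rightarrow> rat"
  budget :: rat

text \<open>Here \<open>nodes\<close> is the set $N$ of non-root nodes, and arcs point away from the root.\<close>

definition rooted_tree :: "'v \<Rightarrow> 'v set \<Rightarrow> ('v \<times> 'v) set \<Rightarrow> bool" where
  "rooted_tree r N A \<longleftrightarrow>
     finite N \<and> r \<notin> N \<and> A \<subseteq> insert r N \<times> N \<and>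
     (\<forall>v\<in>N. \<exists>!u. (u, v) \<in> A) \<and>
     (\<forall>v\<in>N. (r, v) \<in> A\<^sup>*)"

definition tk_instance :: "'v tree_knapsack \<Rightarrow> bool" where
  "tk_instance I \<longleftrightarrow>
     rooted_tree (root I) (nodes I) (arcs I) \<and>
     (\<forall>v\<in>nodes I. 0 \<le> val I v \<and> 0 \<le> wgt I v) \<and>
     0 \<le> budget I"

definition child :: "'v tree_knapsack \<Rightarrow> 'v \<Rightarrow> 'v set" where
  "child I v = {u. (v, u) \<in> arcs I}"

definition tkp_feasible :: "'v tree_knapsack \<Rightarrow> ('v \<Rightarrow> real) \<Rightarrow> bool" where
  "tkp_feasible I x \<longleftrightarrow>
     (\<forall>v\<in>nodes I. \<forall>u\<in>child I v. x v \<le> x u) \<and>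
     (\<Sum>v\<in>nodes I. real_of_rat (wgt I v) * x v) \<le> real_of_rat (budget I) \<and>
     (\<forall>v\<in>nodes I. 0 \<le> x v \<and> x v \<le> 1)"

definition tkp_objective :: "'v tree_knapsack \<Rightarrow> ('v \<Rightarrow> real) \<Rightarrow> real" where
  "tkp_objective I x = (\<Sum>v\<in>nodes I. real_of_rat (val I v) * x v)"

definition tkp_opt :: "'v tree_knapsack \<Rightarrow> real" where
  "tkp_opt I = Sup {tkp_objective I x | x. tkp_feasible I x}"

definition descendant :: "'v tree_knapsack \<Rightarrow> 'v \<Rightarrow> 'v \<Rightarrow> bool" where
  "descendant I u v \<longleftrightarrow> (v, u) \<in> (arcs I)\<^sup>+"

definition is_chain :: "'v tree_knapsack \<Rightarrow> 'v set \<Rightarrow> bool" where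
  "is_chain I C \<longleftrightarrow>
     C \<subseteq> nodes I \<and> (\<forall>u\<in>C. \<forall>v\<in>C. u \<noteq> v \<longrightarrow> descendant I u v \<or> descendant I v u)"

definition max_chain_value :: "'v tree_knapsack \<Rightarrow> real" where
  "max_chain_value I = Max {\<Sum>v\<in>C. real_of_rat (val I v) | C. is_chain I C}"

text \<open>The supremum and the maximum above are over nonempty, bounded sets.\<close>

lemma tkp_values_nonempty_bdd:
  assumes "tk_instance I"
  shows "{tkp_objective I x | x. tkp_feasible I x} \<noteq> {}"
    and "bdd_above {tkp_objective I x | x. tkp_feasible I x}"
proof -
  have "tkp_feasible I (\<lambda>_. 0)"
    using assms by (auto simp: tkp_feasible_def tk_instance_def)
  then show "{tkp_objective I x | x. tkp_feasible I x} \<noteq> {}" by blast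
  show "bdd_above {tkp_objective I x | x. tkp_feasible I x}"
  proof (rule bdd_aboveI)
    fix y assume "y \<in> {tkp_objective I x | x. tkp_feasible I x}"
    then obtain x where x: "tkp_feasible I x" and y: "y = tkp_objective I x" by blast
    show "y \<le> (\<Sum>v\<in>nodes I. real_of_rat (val I v))"
      unfolding y tkp_objective_def
    proof (rule sum_mono)
      fix v assume "v \<in> nodes I"
      with x assms show "real_of_rat (val I v) * x v \<le> real_of_rat (val I v)"
        by (auto simp: tkp_feasible_def tk_instance_def intro!: mult_left_le)
    qed
  qed
qed

lemma chain_values_finite_nonempty:
  assumes "tk_instance I"
  shows "finite {\<Sum>v\<in>C. real_of_rat (val I v) | C. is_chain I C}"
    and "{\<Sum>v\<in>C. real_of_rat (val I v) | C. is_chain I C} \<noteq> {}"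
proof -
  have "finite {C. is_chain I C}"
    using assms
    by (auto simp: tk_instance_def rooted_tree_def is_chain_def
        intro!: finite_subset[of _ "Pow (nodes I)"])
  then show "finite {\<Sum>v\<in>C. real_of_rat (val I v) | C. is_chain I C}" by simp
  have "is_chain I {}" by (simp add: is_chain_def)
  then show "{\<Sum>v\<in>C. real_of_rat (val I v) | C. is_chain I C} \<noteq> {}" by blast
qed

section \<open>Random access machines with logarithmic cost\<close>

text \<open>
  The model of computation is the random access machine over the integers with
  instructions for \<open>+\<close>, \<open>-\<close>, \<open>*\<close>, \<open>div\<close> under the logarithmic cost criterion of
  Aho, Hopcroft and Ullman, which is polynomially equivalent to Turing machines.
  Programs are written as structured commands instead of jumps. The memory is divided
  into named banks, of which a program mentions finitely many; every bank is an unbounded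
  array of integers, and a scalar register is cell 0 of a bank. Every operation is charged
  the binary length of all operands, addresses included.
\<close>

definition int_size :: "int \<Rightarrow> nat" where
  "int_size z = nat (bitlen \<bar>z\<bar>) + 1"

type_synonym memory = "string \<Rightarrow> int \<Rightarrow> int"

datatype aexp =
    Const int
  | Cell string aexp
  | Add aexp aexp
  | Sub aexp aexp
  | Mul aexp aexp
  | Div aexp aexp

datatype bexp =
    Less aexp aexp
  | Not bexp
  | And bexp bexp

datatype com =
    Skip
  | Store string aexp aexp
  | Seq com com
  | If bexp com com
  | While bexp com

fun aval :: "aexp \<Rightarrow> memory \<Rightarrow> int" where
  "aval (Const k) s = k"
| "aval (Cell X i) s = s X (aval i s)"
| "aval (Add a b) s = aval a s + aval b s"
| "aval (Sub a b) s = aval a s - aval b s"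
| "aval (Mul a b) s = aval a s * aval b s"
| "aval (Div a b) s = aval a s div aval b s"

fun acost :: "aexp \<Rightarrow> memory \<Rightarrow> nat" where
  "acost (Const k) s = int_size k"
| "acost (Cell X i) s = acost i s + int_size (aval i s) + int_size (s X (aval i s))"
| "acost (Add a b) s = acost a s + acost b s + int_size (aval a s) + int_size (aval b s)"
| "acost (Sub a b) s = acost a s + acost b s + int_size (aval a s) + int_size (aval b s)"
| "acost (Mul a b) s = acost a s + acost b s + int_size (aval a s) + int_size (aval b s)"
| "acost (Div a b) s = acost a s + acost b s + int_size (aval a s) + int_size (aval b s)"

fun bval :: "bexp \<Rightarrow> memory \<Rightarrow> bool" where
  "bval (Less a b) s \<longleftrightarrow> aval a s < aval b s"
| "bval (Not b) s \<longleftrightarrow> \<not> bval b s"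
| "bval (And b c) s \<longleftrightarrow> bval b s \<and> bval c s"

fun bcost :: "bexp \<Rightarrow> memory \<Rightarrow> nat" where
  "bcost (Less a b) s = acost a s + acost b s + int_size (aval a s) + int_size (aval b s)"
| "bcost (Not b) s = bcost b s + 1"
| "bcost (And b c) s = bcost b s + bcost c s + 1"

text \<open>\<open>exec c s t s'\<close>: command \<open>c\<close> started in memory \<open>s\<close> halts in memory \<open>s'\<close> at total
  cost \<open>t\<close>. In \<open>Store X i a\<close>, cell \<open>i\<close> of bank \<open>X\<close> receives the value of \<open>a\<close>.\<close>

inductive exec :: "com \<Rightarrow> memory \<Rightarrow> nat \<Rightarrow> memory \<Rightarrow> bool" where
  Skip: "exec Skip s 1 s"
| Store: "exec (Store X i a) s
            (acost i s + acost a s + int_size (aval i s) + int_size (aval a s))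
            (s(X := (s X)(aval i s := aval a s)))"
| Seq: "exec c s t s' \<Longrightarrow> exec d s' t' s'' \<Longrightarrow> exec (Seq c d) s (t + t') s''"
| IfTrue: "bval b s \<Longrightarrow> exec c s t s' \<Longrightarrow> exec (If b c d) s (bcost b s + t + 1) s'"
| IfFalse: "\<not> bval b s \<Longrightarrow> exec d s t s' \<Longrightarrow> exec (If b c d) s (bcost b s + t + 1) s'"
| WhileFalse: "\<not> bval b s \<Longrightarrow> exec (While b c) s (bcost b s + 1) s"
| WhileTrue: "bval b s \<Longrightarrow> exec c s t s' \<Longrightarrow> exec (While b c) s' t' s'' \<Longrightarrow>
            exec (While b c) s (bcost b s + t + t' + 1) s''"

inductive_cases SkipE: "exec Skip s t s'"
inductive_cases StoreE: "exec (Store X i a) s t s'"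
inductive_cases SeqE: "exec (Seq c d) s t s'"
inductive_cases IfE: "exec (If b c d) s t s'"
inductive_cases WhileE: "exec (While b c) s t s'"

lemma exec_deterministic:
  "exec c s t s' \<Longrightarrow> exec c s u s'' \<Longrightarrow> u = t \<and> s'' = s'"
proof (induction arbitrary: u s'' rule: exec.induct)
  case (Skip s) then show ?case by (auto elim: SkipE)
next
  case (Store X i a s) then show ?case by (auto elim: StoreE)
next
  case (Seq c s t s' d t' s2)
  from Seq.prems show ?case by (rule SeqE) (metis Seq.IH)
next
  case (IfTrue b s c t s' d)
  from IfTrue.prems show ?case by (rule IfE) (metis Suc_eq_plus1 IfTrue.IH IfTrue.hyps)+
next
  case (IfFalse b s d t s' c)
  from IfFalse.prems show ?case by (rule IfE) (metis Suc_eq_plus1 IfFalse.IH IfFalse.hyps)+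
next
  case (WhileFalse b s c)
  from WhileFalse.prems show ?case by (rule WhileE) (metis Suc_eq_plus1 WhileFalse.hyps)+
next
  case (WhileTrue b s c t s' t' s2)
  from WhileTrue.prems show ?case by (rule WhileE) (metis Suc_eq_plus1 WhileTrue.IH WhileTrue.hyps)+
qed

text \<open>The input occupies the cells \<open>0, 1, \<dots>\<close> of one bank; all other memory is zero.\<close>

definition init_memory :: "int list \<Rightarrow> memory" where
  "init_memory xs = (\<lambda>X i.
     if X = ''in'' \<and> 0 \<le> i \<and> i < int (length xs) then xs ! nat i else 0)"

definition input_size :: "int list \<Rightarrow> nat" where
  "input_size xs = (\<Sum>z\<leftarrow>xs. int_size z)"

section \<open>Encoding of instances and solutions\<close>

text \<open>As usual for graph algorithms, the nodes of an input are numbered: the root is \<open>0\<close> and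
  $N = \{1, \dots, n\}$, in no particular order. The tree is given by its parent array, and a
  rational number by numerator and denominator in lowest terms.\<close>

definition numbered :: "nat tree_knapsack \<Rightarrow> bool" where
  "numbered I \<longleftrightarrow> root I = 0 \<and> nodes I = {1..card (nodes I)}"

definition parent :: "nat tree_knapsack \<Rightarrow> nat \<Rightarrow> nat" where
  "parent I v = (THE u. (u, v) \<in> arcs I)"

definition encode_rat :: "rat \<Rightarrow> int list" where
  "encode_rat q = [fst (quotient_of q), snd (quotient_of q)]"

definition encode :: "nat tree_knapsack \<Rightarrow> int list" where
  "encode I =
     int (card (nodes I)) # encode_rat (budget I) @
     concat (map (\<lambda>v. int (parent I v) # encode_rat (val I v) @ encode_rat (wgt I v))
                 [1..<card (nodes I) + 1])"

definition output_vector :: "memory \<Rightarrow> nat \<Rightarrow> real" where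
  "output_vector s v = real_of_int (s ''out'' (int v))"

end

theory Submission
  imports Defs
begin

text \<open>
  Feasible sets are closed under descendants. Keep a set \<open>A\<close> of active nodes, a set \<open>S\<close> of chosen nodes
  and the remaining budget \<open>r\<close>. Pick an active node \<open>v\<close> whose active subtree \<open>R\<close> has the largest ratio
  of value to weight. If \<open>R\<close> fits into the budget, move it to \<open>S\<close>; otherwise give up \<open>v\<close> and continue
  with \<open>A = R - {v}\<close>. Every node given up later is a descendant of \<open>v\<close>, so the nodes given up form a
  chain \<open>C\<close>. The Lagrangian dual bound of the relaxation on \<open>A\<close> with budget \<open>r\<close> drops by at most
  \<open>\<alpha>(R)\<close> in the first case, because the multiplier equal to the density of \<open>R\<close> makes taking \<open>R\<close>
  optimal, and by at most \<open>\<alpha>\<^sub>v\<close> in the second, as witnessed by the vector that is constantly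
  \<open>r / \<beta>(R)\<close> on \<open>R - {v}\<close>. When \<open>A\<close> is empty the bound is \<open>0\<close>, so \<open>OPT \<le> \<alpha>(S) + \<alpha>(C)\<close>.

  On the machine all data are scaled to integers by the product of the denominators. Loops run at most
  \<open>n\<close> times, and stored values are only added to each other or multiplied by input numbers, so
  their lengths grow linearly in the number of steps.
\<close>

section \<open>Weakest preconditions with bounded loops\<close>

text \<open>\<open>wp N c Q s\<close>: started in \<open>s\<close>, \<open>c\<close> halts in a memory satisfying \<open>Q\<close>, and each entry of a
  while loop performs at most \<open>N\<close> iterations.\<close>

primrec loop_wp :: "nat \<Rightarrow> bexp \<Rightarrow> ((memory \<Rightarrow> bool) \<Rightarrow> memory \<Rightarrow> bool)
    \<Rightarrow> (memory \<Rightarrow> bool) \<Rightarrow> memory \<Rightarrow> bool" where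
  "loop_wp 0 b W Q = (\<lambda>s. \<not> bval b s \<and> Q s)"
| "loop_wp (Suc k) b W Q = (\<lambda>s. if bval b s then W (loop_wp k b W Q) s else Q s)"

primrec wp :: "nat \<Rightarrow> com \<Rightarrow> (memory \<Rightarrow> bool) \<Rightarrow> memory \<Rightarrow> bool" where
  "wp N Skip Q = Q"
| "wp N (Store X i a) Q = (\<lambda>s. Q (s(X := (s X)(aval i s := aval a s))))"
| "wp N (Seq c d) Q = wp N c (wp N d Q)"
| "wp N (If b c d) Q = (\<lambda>s. if bval b s then wp N c Q s else wp N d Q s)"
| "wp N (While b c) Q = loop_wp N b (wp N c) Q"

primrec writes :: "com \<Rightarrow> string set" where
  "writes Skip = {}"
| "writes (Store X i a) = {X}"
| "writes (Seq c d) = writes c \<union> writes d"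
| "writes (If b c d) = writes c \<union> writes d"
| "writes (While b c) = writes c"

lemma loop_wp_mono:
  assumes "\<And>Q Q' s. W Q s \<Longrightarrow> (\<And>s'. Q s' \<Longrightarrow> Q' s') \<Longrightarrow> W Q' s"
    and "loop_wp k b W Q s" and "\<And>s'. Q s' \<Longrightarrow> Q' s'"
  shows "loop_wp k b W Q' s"
  using assms(2)
proof (induction k arbitrary: s)
  case 0 then show ?case using assms(3) by auto
next
  case (Suc k)
  then show ?case using assms(1)[of "loop_wp k b W Q" s "loop_wp k b W Q'"] assms(3)
    by (auto split: if_splits)
qed

lemma wp_mono:
  "wp N c Q s \<Longrightarrow> (\<And>s'. Q s' \<Longrightarrow> Q' s') \<Longrightarrow> wp N c Q' s"
proof (induction c arbitrary: s Q Q')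
  case (Seq c d)
  from Seq.prems(1) have "wp N c (wp N d Q) s" by simp
  then show ?case using Seq.IH(1)[of "wp N d Q" s "wp N d Q'"] Seq.IH(2)[of Q _ Q'] Seq.prems(2)
    by simp
next
  case (If b c d)
  then show ?case by (auto split: if_splits)
next
  case (While b c)
  show ?case
    using loop_wp_mono[of "wp N c" N b Q s Q'] While by simp
qed auto

text \<open>Lets a subprogram be specified by the banks it changes alone: whatever a caller knows
  about the other banks survives by the syntactic check \<open>writes\<close>.\<close>

lemma wp_frame:
  "wp N c Q s \<Longrightarrow> wp N c (\<lambda>s'. Q s' \<and> (\<forall>X. X \<notin> writes c \<longrightarrow> s' X = s X)) s"
proof (induction c arbitrary: s Q)
  case (Seq c d)
  from Seq.prems have "wp N c (wp N d Q) s" by simp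
  from Seq.IH(1)[OF this]
  have "wp N c (wp N d (\<lambda>s'. Q s' \<and> (\<forall>X. X \<notin> writes (Seq c d) \<longrightarrow> s' X = s X))) s"
  proof (rule wp_mono, goal_cases)
    case (1 s1)
    then have "wp N d (\<lambda>s'. Q s' \<and> (\<forall>X. X \<notin> writes d \<longrightarrow> s' X = s1 X)) s1"
      using Seq.IH(2) by blast
    then show ?case by (rule wp_mono) (use 1 in auto)
  qed
  then show ?case by simp
next
  case (If b c d)
  show ?case
  proof (cases "bval b s")
    case True
    then have "wp N c Q s" using If.prems by simp
    from If.IH(1)[OF this]
    have "wp N c (\<lambda>s'. Q s' \<and> (\<forall>X. X \<notin> writes (If b c d) \<longrightarrow> s' X = s X)) s"
      by (rule wp_mono) auto
    then show ?thesis using True by simp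
  next
    case False
    then have "wp N d Q s" using If.prems by simp
    from If.IH(2)[OF this]
    have "wp N d (\<lambda>s'. Q s' \<and> (\<forall>X. X \<notin> writes (If b c d) \<longrightarrow> s' X = s X)) s"
      by (rule wp_mono) auto
    then show ?thesis using False by simp
  qed
next
  case (While b c)
  have "loop_wp k b (wp N c) Q s \<Longrightarrow>
    loop_wp k b (wp N c) (\<lambda>s'. Q s' \<and> (\<forall>X. X \<notin> writes c \<longrightarrow> s' X = s X)) s" for k s
  proof (induction k arbitrary: s)
    case 0 then show ?case by simp
  next
    case (Suc k)
    show ?case
    proof (cases "bval b s")
      case True
      then have "wp N c (loop_wp k b (wp N c) Q) s" using Suc.prems by simp
      from While.IH[OF this]
      have "wp N c (loop_wp k b (wp N c) (\<lambda>s'. Q s' \<and> (\<forall>X. X \<notin> writes c \<longrightarrow> s' X = s X))) s"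
      proof (rule wp_mono, goal_cases)
        case (1 s1)
        then have "loop_wp k b (wp N c) (\<lambda>s'. Q s' \<and> (\<forall>X. X \<notin> writes c \<longrightarrow> s' X = s1 X)) s1"
          using Suc.IH by blast
        then show ?case
          by (rule loop_wp_mono[rotated]) (use 1 in \<open>auto elim: wp_mono\<close>)
      qed
      then show ?thesis using True by simp
    next
      case False
      then show ?thesis using Suc.prems by simp
    qed
  qed
  then show ?case using While.prems by simp
qed auto

lemma wp_consequence:
  assumes "wp N c R s" and "\<And>s'. R s' \<Longrightarrow> (\<And>X. X \<notin> writes c \<Longrightarrow> s' X = s X) \<Longrightarrow> Q s'"
  shows "wp N c Q s"
  using wp_frame[OF assms(1)] by (rule wp_mono) (use assms(2) in auto)

text \<open>A measure that starts at most at \<open>N\<close> and decreases yields termination and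
  the iteration bound at once. Its positivity while the guard holds ensures that fuel 0 is met only
  when the guard fails.\<close>

lemma wp_while_measure:
  assumes "I s" and "m s \<le> N"
    and "\<And>s. I s \<Longrightarrow> bval b s \<Longrightarrow> wp N c (\<lambda>s'. I s' \<and> m s' < (m s :: nat)) s"
    and "\<And>s. I s \<Longrightarrow> \<not> bval b s \<Longrightarrow> Q s"
    and "\<And>s. I s \<Longrightarrow> bval b s \<Longrightarrow> 0 < m s"
  shows "wp N (While b c) Q s"
proof -
  have "I s \<Longrightarrow> m s \<le> k \<Longrightarrow> loop_wp k b (wp N c) Q s" for k s
  proof (induction k arbitrary: s)
    case 0
    then have "\<not> bval b s" using assms(5)[of s] by auto
    then show ?case using assms(4) 0 by simp
  next
    case (Suc k)
    show ?case
    proof (cases "bval b s")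
      case True
      from assms(3)[OF Suc.prems(1) True]
      have "wp N c (loop_wp k b (wp N c) Q) s"
        by (rule wp_mono) (use Suc in auto)
      then show ?thesis using True by simp
    next
      case False
      then show ?thesis using assms(4) Suc.prems by simp
    qed
  qed
  then show ?thesis using assms(1,2) by simp
qed

abbreviation reg :: "string \<Rightarrow> aexp" where "reg X \<equiv> Cell X (Const 0)"
abbreviation set_reg :: "string \<Rightarrow> aexp \<Rightarrow> com" where "set_reg X a \<equiv> Store X (Const 0) a"

definition for_nodes :: "string \<Rightarrow> com \<Rightarrow> com" where
  "for_nodes X c = Seq (set_reg X (Const 1))
     (While (Less (reg X) (Add (reg ''in'') (Const 1)))
       (Seq c (set_reg X (Add (reg X) (Const 1)))))"

lemma writes_for_nodes [simp]: "writes (for_nodes X c) = insert X (writes c)"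
  by (auto simp: for_nodes_def)

text \<open>\<open>I j\<close> describes the memory just before pass j, with the counter already set
  to j; hence the counter update inside the postcondition of \<open>step\<close>. The frame premise
  refers to the memory \<open>s\<close> before the whole loop.\<close>

lemma wp_for_nodes:
  assumes n: "s ''in'' 0 = int n" "n \<le> N"
    and X: "X \<notin> writes c" "X \<noteq> ''in''" "''in'' \<notin> writes c"
    and init: "I 1 (s(X := (s X)(0 := 1)))"
    and step: "\<And>j s'. 1 \<le> j \<Longrightarrow> j \<le> n \<Longrightarrow> s' X 0 = int j \<Longrightarrow> I j s' \<Longrightarrow>
        (\<And>Y. Y \<noteq> X \<Longrightarrow> Y \<notin> writes c \<Longrightarrow> s' Y = s Y) \<Longrightarrow>
        wp N c (\<lambda>s''. I (Suc j) (s''(X := (s'' X)(0 := int (Suc j))))) s'"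
    and final: "\<And>s'. I (Suc n) s' \<Longrightarrow> Q s'"
  shows "wp N (for_nodes X c) Q s"
proof -
  let ?J = "\<lambda>s'. \<exists>j. 1 \<le> j \<and> j \<le> Suc n \<and> s' X 0 = int j \<and> I j s' \<and>
        (\<forall>Y. Y \<noteq> X \<longrightarrow> Y \<notin> writes c \<longrightarrow> s' Y = s Y)"
  let ?m = "\<lambda>s'. nat (int (Suc n) - s' X 0)"
  have "wp N (While (Less (reg X) (Add (reg ''in'') (Const 1)))
       (Seq c (set_reg X (Add (reg X) (Const 1))))) Q (s(X := (s X)(0 := 1)))"
  proof (rule wp_while_measure[where I = ?J and m = ?m])
    show "?J (s(X := (s X)(0 := 1)))" using init by (intro exI[of _ 1]) auto
    show "?m (s(X := (s X)(0 := 1))) \<le> N" using n by simp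
  next
    fix s' assume "?J s'" and b: "bval (Less (reg X) (Add (reg ''in'') (Const 1))) s'"
    then obtain j where j: "1 \<le> j" "j \<le> Suc n" "s' X 0 = int j" "I j s'"
      and fr: "\<And>Y. Y \<noteq> X \<Longrightarrow> Y \<notin> writes c \<Longrightarrow> s' Y = s Y" by blast
    have "s' ''in'' 0 = int n" using fr[of "''in''"] X n by auto
    with b j have jn: "j \<le> n" by simp
    have "wp N c (\<lambda>s''. I (Suc j) (s''(X := (s'' X)(0 := int (Suc j))))) s'"
      using step j jn fr by blast
    then have "wp N c (\<lambda>s''. ?J (s''(X := (s'' X)(0 := s'' X 0 + 1))) \<and>
        ?m (s''(X := (s'' X)(0 := s'' X 0 + 1))) < ?m s') s'"
    proof (rule wp_consequence, goal_cases)
      case (1 s2)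
      have "s2 X 0 = int j" using 1 X j by simp
      with 1 jn j fr show ?case by (auto intro!: exI[of _ "Suc j"] simp: add.commute)
    qed
    then show "wp N (Seq c (set_reg X (Add (reg X) (Const 1)))) (\<lambda>s''. ?J s'' \<and> ?m s'' < ?m s') s'"
      by (simp only: wp.simps aval.simps)
  next
    fix s' assume "?J s'" and b: "\<not> bval (Less (reg X) (Add (reg ''in'') (Const 1))) s'"
    then obtain j where j: "1 \<le> j" "j \<le> Suc n" "s' X 0 = int j" "I j s'"
      and fr: "\<And>Y. Y \<noteq> X \<Longrightarrow> Y \<notin> writes c \<Longrightarrow> s' Y = s Y" by blast
    have "s' ''in'' 0 = int n" using fr[of "''in''"] X n by auto
    with b j have "j = Suc n" by simp
    then show "Q s'" using j final by simp
  next
    fix s' assume "?J s'" and b: "bval (Less (reg X) (Add (reg ''in'') (Const 1))) s'"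
    then obtain j where j: "s' X 0 = int j"
      and fr: "\<And>Y. Y \<noteq> X \<Longrightarrow> Y \<notin> writes c \<Longrightarrow> s' Y = s Y" by blast
    have "s' ''in'' 0 = int n" using fr[of "''in''"] X n by auto
    with b show "0 < ?m s'" by simp
  qed
  then show ?thesis by (simp add: for_nodes_def)
qed

section \<open>From loop bounds to logarithmic cost\<close>

text \<open>Two bounds, because programs with \<open>linear_stores\<close> never write the bank
  \<open>in\<close>: its entries keep L bits while M grows during the run.\<close>

definition bounded_memory :: "nat \<Rightarrow> nat \<Rightarrow> memory \<Rightarrow> bool" where
  "bounded_memory L M s \<longleftrightarrow> 1 \<le> L \<and> L \<le> M \<and>
     (\<forall>i. \<bar>s ''in'' i\<bar> < 2 ^ L) \<and> (\<forall>X i. \<bar>s X i\<bar> < 2 ^ M)"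

text \<open>If the input has \<open>L\<close>-bit entries and all of memory \<open>M\<close>-bit entries, the value of \<open>e\<close> has
  at most \<open>deg e * M + wid e * L\<close> bits.\<close>

primrec deg :: "aexp \<Rightarrow> nat" where
  "deg (Const k) = 0"
| "deg (Cell X i) = (if X = ''in'' then 0 else 1)"
| "deg (Add a b) = max (deg a) (deg b)"
| "deg (Sub a b) = max (deg a) (deg b)"
| "deg (Mul a b) = deg a + deg b"
| "deg (Div a b) = deg a"

primrec wid :: "aexp \<Rightarrow> nat" where
  "wid (Const k) = int_size k"
| "wid (Cell X i) = (if X = ''in'' then 1 else 0)"
| "wid (Add a b) = max (wid a) (wid b) + 1"
| "wid (Sub a b) = max (wid a) (wid b) + 1"
| "wid (Mul a b) = wid a + wid b"
| "wid (Div a b) = wid a"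

text \<open>Since L \<le> M and 1 \<le> M, \<open>width a * M\<close> dominates the bit bound
  \<open>deg a * M + wid a * L\<close> plus the extra unit in \<open>int_size\<close>.\<close>

definition width :: "aexp \<Rightarrow> nat" where
  "width a = deg a + wid a + 1"

text \<open>Chosen so that the cost is at most the coefficient times M. The 2 for a memory access is
  the \<open>width\<close> of any \<open>Cell\<close> and pays for the fetched value.\<close>

primrec acoeff :: "aexp \<Rightarrow> nat" where
  "acoeff (Const k) = int_size k"
| "acoeff (Cell X i) = acoeff i + width i + 2"
| "acoeff (Add a b) = acoeff a + acoeff b + width a + width b"
| "acoeff (Sub a b) = acoeff a + acoeff b + width a + width b"
| "acoeff (Mul a b) = acoeff a + acoeff b + width a + width b"
| "acoeff (Div a b) = acoeff a + acoeff b + width a + width b"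

primrec bcoeff :: "bexp \<Rightarrow> nat" where
  "bcoeff (Less a b) = acoeff a + acoeff b + width a + width b"
| "bcoeff (Not b) = bcoeff b + 1"
| "bcoeff (And b c) = bcoeff b + bcoeff c + 1"

primrec ccoeff :: "com \<Rightarrow> nat" where
  "ccoeff Skip = 1"
| "ccoeff (Store X i a) = acoeff i + acoeff a + width i + width a"
| "ccoeff (Seq c d) = ccoeff c + ccoeff d"
| "ccoeff (If b c d) = bcoeff b + 1 + ccoeff c + ccoeff d"
| "ccoeff (While b c) = bcoeff b + 1 + ccoeff c"

text \<open>A sum over all stores, hence a bound on \<open>wid\<close> for each single one.\<close>

primrec growth :: "com \<Rightarrow> nat" where
  "growth Skip = 0"
| "growth (Store X i a) = wid a"
| "growth (Seq c d) = growth c + growth d"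
| "growth (If b c d) = growth c + growth d"
| "growth (While b c) = growth c"

text \<open>Stores of degree 2 would allow repeated squaring, with exponentially long numbers. With
  degree at most 1, a store adds at most \<open>wid a * L\<close> bits to the longest number in
  memory.\<close>

primrec linear_stores :: "com \<Rightarrow> bool" where
  "linear_stores Skip \<longleftrightarrow> True"
| "linear_stores (Store X i a) \<longleftrightarrow> X \<noteq> ''in'' \<and> deg a \<le> 1"
| "linear_stores (Seq c d) \<longleftrightarrow> linear_stores c \<and> linear_stores d"
| "linear_stores (If b c d) \<longleftrightarrow> linear_stores c \<and> linear_stores d"
| "linear_stores (While b c) \<longleftrightarrow> linear_stores c"

text \<open>Evaluated at the loop bound N. The factor \<open>[:1, 1:]\<close> is N + 1: N passes and
  the final failing test of the guard.\<close>

primrec step_poly :: "com \<Rightarrow> nat poly" where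
  "step_poly Skip = 1"
| "step_poly (Store X i a) = 1"
| "step_poly (Seq c d) = step_poly c + step_poly d"
| "step_poly (If b c d) = 1 + step_poly c + step_poly d"
| "step_poly (While b c) = [:1, 1:] * (1 + step_poly c)"

section \<open>Bit lengths of numbers and of expression values\<close>

lemma int_size_le: "\<bar>z\<bar> < 2 ^ k \<Longrightarrow> int_size z \<le> k + 1"
  using bitlen_le_iff_power[of "\<bar>z\<bar>" k] by (simp add: int_size_def)

lemma less_power_int_size: "\<bar>z\<bar> < 2 ^ int_size z"
proof -
  have "\<bar>z\<bar> < 2 ^ nat (bitlen \<bar>z\<bar>)"
    using bitlen_le_iff_power[of "\<bar>z\<bar>" "nat (bitlen \<bar>z\<bar>)"] bitlen_nonneg[of "\<bar>z\<bar>"] by simp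
  also have "\<dots> \<le> 2 ^ int_size z" by (simp add: int_size_def)
  finally show ?thesis .
qed

lemma int_size_pos: "1 \<le> int_size z"
  by (simp add: int_size_def)

text \<open>This is why \<open>deg\<close> and \<open>wid\<close> of a quotient look only at the
  dividend. Division by 0 yields 0, and a negative divisor is handled by negating both
  operands.\<close>

lemma abs_div_le: "\<bar>a div b\<bar> \<le> \<bar>a :: int\<bar>"
proof -
  have pos: "\<bar>a div b\<bar> \<le> \<bar>a\<bar>" if "0 < b" for a b :: int
  proof (cases "0 \<le> a")
    case True
    then show ?thesis
      using that zdiv_mono2[of a 1 b] pos_imp_zdiv_nonneg_iff[of b a] by simp
  next
    case False
    then show ?thesis
      using that zdiv_mono2_neg[of a 1 b] pos_imp_zdiv_neg_iff[of b a] by simp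
  qed
  consider "b = 0" | "0 < b" | "0 < - b" by linarith
  then show ?thesis
  proof cases
    case 3
    then show ?thesis using pos[of "- b" "- a"] by simp
  qed (use pos in auto)
qed

lemma abs_lt_power_mono: "\<bar>z :: int\<bar> < 2 ^ j \<Longrightarrow> j \<le> k \<Longrightarrow> \<bar>z\<bar> < 2 ^ k"
  by (meson less_le_trans one_le_numeral power_increasing)

lemma abs_sum_lt_power: 
  assumes "\<bar>x :: int\<bar> < 2 ^ j" "\<bar>y\<bar> < 2 ^ k" "max j k < m"
  shows "\<bar>x\<bar> + \<bar>y\<bar> < 2 ^ m"
proof -
  have "\<bar>x\<bar> < 2 ^ max j k" "\<bar>y\<bar> < 2 ^ max j k"
    using assms by (auto elim: abs_lt_power_mono)
  then have "\<bar>x\<bar> + \<bar>y\<bar> < 2 ^ Suc (max j k)" by simp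
  also have "\<dots> \<le> 2 ^ m" using assms(3) by (intro power_increasing) auto
  finally show ?thesis .
qed

text \<open>A sum or difference may need one bit more than its longer operand. Raising
  \<open>wid\<close> by 1 adds L \<ge> 1 bits, which covers it.\<close>

lemma max_affine_less:
  fixes d d' w w' :: nat
  assumes "1 \<le> L"
  shows "max (d * M + w * L) (d' * M + w' * L) < max d d' * M + (max w w' + 1) * L"
proof -
  have "d * M \<le> max d d' * M" "d' * M \<le> max d d' * M"
    "w * L \<le> max w w' * L" "w' * L \<le> max w w' * L" by simp_all
  then have "d * M + w * L < max d d' * M + max w w' * L + L"
    "d' * M + w' * L < max d d' * M + max w w' * L + L"
    using assms by linarith+
  then show ?thesis by (simp only: max_less_iff_conj add_mult_distrib mult_1 add.assoc simp_thms)
qed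

lemma aval_bound:
  assumes "bounded_memory L M s"
  shows "\<bar>aval e s\<bar> < 2 ^ (deg e * M + wid e * L)"
proof (induction e)
  case (Const k)
  have "int_size k \<le> int_size k * L" using assms by (simp add: bounded_memory_def)
  then show ?case using abs_lt_power_mono[OF less_power_int_size] by simp
next
  case (Cell X i)
  then show ?case using assms by (auto simp: bounded_memory_def)
next
  case (Add a b)
  have "\<bar>aval a s\<bar> + \<bar>aval b s\<bar> < 2 ^ (deg (Add a b) * M + wid (Add a b) * L)"
    using abs_sum_lt_power[OF Add max_affine_less] assms by (simp add: bounded_memory_def)
  then show ?case using abs_triangle_ineq[of "aval a s" "aval b s"] by simp
next
  case (Sub a b)
  have "\<bar>aval a s\<bar> + \<bar>aval b s\<bar> < 2 ^ (deg (Sub a b) * M + wid (Sub a b) * L)"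
    using abs_sum_lt_power[OF Sub max_affine_less] assms by (simp add: bounded_memory_def)
  then show ?case using abs_triangle_ineq4[of "aval a s" "aval b s"] by simp
next
  case (Mul a b)
  have "\<bar>aval a s * aval b s\<bar> < 2 ^ (deg a * M + wid a * L) * 2 ^ (deg b * M + wid b * L)"
    unfolding abs_mult by (rule mult_strict_mono') (use Mul in auto)
  then show ?case by (simp add: power_add algebra_simps)
next
  case (Div a b)
  then show ?case using abs_div_le[of "aval a s" "aval b s"] by simp
qed

lemma int_size_aval:
  assumes "bounded_memory L M s"
  shows "int_size (aval e s) \<le> width e * M"
proof -
  have "int_size (aval e s) \<le> deg e * M + wid e * L + 1"
    using aval_bound[OF assms] by (rule int_size_le)
  also have "\<dots> \<le> deg e * M + wid e * M + M"
    using assms by (intro add_mono mult_left_mono) (auto simp: bounded_memory_def)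
  finally show ?thesis by (simp add: width_def algebra_simps)
qed

lemma acost_bound:
  assumes "bounded_memory L M s"
  shows "acost e s \<le> acoeff e * M"
proof (induction e)
  case (Const k)
  then show ?case using assms by (simp add: bounded_memory_def)
next
  case (Cell X i)
  have "width (Cell X i) = 2" by (simp add: width_def)
  then show ?case
    using Cell int_size_aval[OF assms, of i] int_size_aval[OF assms, of "Cell X i"]
    by (simp add: algebra_simps)
next
  case (Add a b)
  then show ?case using int_size_aval[OF assms, of a] int_size_aval[OF assms, of b]
    by (simp add: algebra_simps)
next
  case (Sub a b)
  then show ?case using int_size_aval[OF assms, of a] int_size_aval[OF assms, of b]
    by (simp add: algebra_simps)
next
  case (Mul a b)
  then show ?case using int_size_aval[OF assms, of a] int_size_aval[OF assms, of b]
    by (simp add: algebra_simps)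
next
  case (Div a b)
  then show ?case using int_size_aval[OF assms, of a] int_size_aval[OF assms, of b]
    by (simp add: algebra_simps)
qed

lemma bcost_bound:
  assumes "bounded_memory L M s"
  shows "bcost b s \<le> bcoeff b * M"
proof (induction b)
  case (Less a b)
  then show ?case
    using int_size_aval[OF assms, of a] int_size_aval[OF assms, of b]
      acost_bound[OF assms, of a] acost_bound[OF assms, of b]
    by (simp add: algebra_simps)
qed (use assms in \<open>auto simp: algebra_simps bounded_memory_def\<close>)

section \<open>Growth of memory and total cost of a run\<close>

lemma bounded_memory_mono:
  "bounded_memory L M s \<Longrightarrow> M \<le> M' \<Longrightarrow> bounded_memory L M' s"
  unfolding bounded_memory_def by (meson abs_lt_power_mono order_trans)

lemma bounded_memory_store:
  assumes "bounded_memory L M s" and "X \<noteq> ''in''" and "deg a \<le> 1" and "wid a \<le> W"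
  shows "bounded_memory L (M + W * L) (s(X := (s X)(i := aval a s)))"
proof -
  have "deg a * M + wid a * L \<le> 1 * M + W * L"
    using assms(3,4) by (intro add_mono mult_right_mono) auto
  then have "\<bar>aval a s\<bar> < 2 ^ (M + W * L)"
    using aval_bound[OF assms(1), of a] by (auto elim: abs_lt_power_mono)
  then show ?thesis
    using bounded_memory_mono[OF assms(1), of "M + W * L"] assms(2)
    by (auto simp: bounded_memory_def)
qed

text \<open>Every store lengthens the numbers in memory by at most \<open>W * L\<close> bits, so the number of steps
  bounds all lengths, and hence the logarithmic cost of every step, by a number \<open>F\<close>.\<close>

lemma wp_imp_exec:
  assumes "wp N c Q s" "linear_stores c" "growth c \<le> W" "ccoeff c \<le> K" "bounded_memory L M s"
    "M + W * L * poly (step_poly c) N \<le> F"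
  shows "\<exists>t s'. exec c s t s' \<and> Q s' \<and> t \<le> poly (step_poly c) N * (K * F) \<and>
           bounded_memory L (M + W * L * poly (step_poly c) N) s'"
  using assms
proof (induction c arbitrary: s Q M)
  case Skip
  have "1 * 1 \<le> K * F" using Skip by (intro mult_le_mono) (auto simp: bounded_memory_def)
  then show ?case using Skip by (force intro: exec.Skip bounded_memory_mono)
next
  case (Store X i a)
  let ?s = "s(X := (s X)(aval i s := aval a s))"
  let ?t = "acost i s + acost a s + int_size (aval i s) + int_size (aval a s)"
  have bs: "bounded_memory L M s" using Store by blast
  have "?t \<le> ccoeff (Store X i a) * M"
    using acost_bound[OF bs, of i] acost_bound[OF bs, of a] int_size_aval[OF bs, of i]
      int_size_aval[OF bs, of a] by (simp add: algebra_simps)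
  also have "\<dots> \<le> K * F" using Store by (intro mult_le_mono) auto
  finally have "?t \<le> K * F" .
  moreover have "bounded_memory L (M + W * L) ?s"
    using Store by (intro bounded_memory_store) auto
  ultimately show ?case using exec.Store[of X i a s] Store.prems(1) by force
next
  case (Seq c d)
  let ?c = "poly (step_poly c) N" and ?d = "poly (step_poly d) N"
  have "wp N c (wp N d Q) s" using Seq by simp
  moreover have le: "M + W * L * ?c + W * L * ?d \<le> F" using Seq.prems by (simp add: algebra_simps)
  ultimately obtain t s1 where 1: "exec c s t s1" "wp N d Q s1" "t \<le> ?c * (K * F)"
    "bounded_memory L (M + W * L * ?c) s1"
    using Seq.IH(1)[of "wp N d Q" s M] Seq.prems by auto
  moreover obtain t' s2 where 2: "exec d s1 t' s2" "Q s2" "t' \<le> ?d * (K * F)"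
    "bounded_memory L (M + W * L * ?c + W * L * ?d) s2"
    using Seq.IH(2)[of Q s1 "M + W * L * ?c"] Seq.prems 1 le by auto
  ultimately show ?case using exec.Seq[OF 1(1) 2(1)]
    by (intro exI[of _ "t + t'"] exI[of _ s2]) (auto simp: algebra_simps)
next
  case (If b c d)
  let ?c = "poly (step_poly c) N" and ?d = "poly (step_poly d) N"
  have bs: "bounded_memory L M s" using If by blast
  have "bcost b s + 1 \<le> (bcoeff b + 1) * M"
    using bcost_bound[OF bs, of b] bs by (simp add: bounded_memory_def)
  also have "\<dots> \<le> K * F" using If by (intro mult_le_mono) auto
  finally have bc: "bcost b s + 1 \<le> K * F" .
  show ?case
  proof (cases "bval b s")
    case True
    have "M + W * L * ?c \<le> F" using If.prems by (simp add: algebra_simps)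
    then obtain t s1 where 1: "exec c s t s1" "Q s1" "t \<le> ?c * (K * F)"
      "bounded_memory L (M + W * L * ?c) s1"
      using If.IH(1)[of Q s M] If.prems True by auto
    moreover have "bounded_memory L (M + W * L * (1 + ?c + ?d)) s1"
      using 1(4) by (rule bounded_memory_mono) (simp add: algebra_simps)
    ultimately show ?thesis using exec.IfTrue[OF True 1(1), of d] bc
      by (intro exI[of _ "bcost b s + t + 1"] exI[of _ s1]) (auto simp: algebra_simps)
  next
    case False
    have "M + W * L * ?d \<le> F" using If.prems by (simp add: algebra_simps)
    then obtain t s1 where 1: "exec d s t s1" "Q s1" "t \<le> ?d * (K * F)"
      "bounded_memory L (M + W * L * ?d) s1"
      using If.IH(2)[of Q s M] If.prems False by auto
    moreover have "bounded_memory L (M + W * L * (1 + ?c + ?d)) s1"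
      using 1(4) by (rule bounded_memory_mono) (simp add: algebra_simps)
    ultimately show ?thesis using exec.IfFalse[OF False 1(1), of c] bc
      by (intro exI[of _ "bcost b s + t + 1"] exI[of _ s1]) (auto simp: algebra_simps)
  qed
next
  case (While b c)
  let ?c = "1 + poly (step_poly c) N"
  have cond: "bcost b s + 1 \<le> K * F" if "bounded_memory L M s" "M \<le> F" for s M
  proof -
    have "bcost b s + 1 \<le> (bcoeff b + 1) * M"
      using bcost_bound[OF that(1), of b] that(1) by (simp add: bounded_memory_def)
    also have "\<dots> \<le> K * F" using While.prems that by (intro mult_le_mono) auto
    finally show ?thesis .
  qed
  \<comment> \<open>One \<open>?c\<close> pays for a guard test and a run of the body. Fuel k allows
    k passes and k + 1 guard tests, hence the factor \<open>Suc k\<close>; k = N gives the factor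
    \<open>[:1, 1:]\<close> of \<open>step_poly\<close>.\<close>
  have "\<exists>t s'. exec (While b c) s t s' \<and> Q s' \<and> t \<le> (Suc k * ?c) * (K * F) \<and>
          bounded_memory L (M + W * L * (Suc k * ?c)) s'"
    if "loop_wp k b (wp N c) Q s" "bounded_memory L M s" "M + W * L * (Suc k * ?c) \<le> F" for k s M
    using that
  proof (induction k arbitrary: s M)
    case 0
    have "bcost b s + 1 \<le> K * F" using cond[OF 0(2)] 0(3) by simp
    moreover have "exec (While b c) s (bcost b s + 1) s" using 0 by (intro WhileFalse) simp
    moreover have "bounded_memory L (M + W * L * (Suc 0 * ?c)) s"
      using 0(2) by (rule bounded_memory_mono) simp
    moreover have "K * F \<le> (Suc 0 * ?c) * (K * F)" by simp
    moreover have "Q s" using 0(1) by simp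
    ultimately show ?case using le_trans by blast
  next
    case (Suc k)
    have bc: "bcost b s + 1 \<le> K * F" using cond[OF Suc.prems(2)] Suc.prems(3) by simp
    show ?case
    proof (cases "bval b s")
      case False
      then have "exec (While b c) s (bcost b s + 1) s" by (intro WhileFalse)
      moreover have "bounded_memory L (M + W * L * (Suc (Suc k) * ?c)) s"
        using Suc.prems(2) by (rule bounded_memory_mono) simp
      moreover have "K * F \<le> (Suc (Suc k) * ?c) * (K * F)" by simp
      moreover have "Q s" using Suc.prems(1) False by simp
      ultimately show ?thesis using bc le_trans by blast
    next
      case True
      let ?M = "M + W * L * poly (step_poly c) N"
      have le: "?M + W * L * (Suc k * ?c) \<le> F" using Suc.prems(3) by (simp add: algebra_simps)
      have "wp N c (loop_wp k b (wp N c) Q) s" using Suc.prems True by simp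
      then obtain t s1 where 1: "exec c s t s1" "loop_wp k b (wp N c) Q s1"
        "t \<le> poly (step_poly c) N * (K * F)" "bounded_memory L ?M s1"
        using While.IH[of "loop_wp k b (wp N c) Q" s M] While.prems Suc.prems le by auto
      obtain t' s2 where 2: "exec (While b c) s1 t' s2" "Q s2" "t' \<le> (Suc k * ?c) * (K * F)"
        "bounded_memory L (?M + W * L * (Suc k * ?c)) s2"
        using Suc.IH[OF 1(2,4) le] by blast
      have "bounded_memory L (M + W * L * (Suc (Suc k) * ?c)) s2"
        using 2(4) by (rule bounded_memory_mono) (simp add: algebra_simps)
      moreover have "bcost b s + t + t' + 1 \<le> (Suc (Suc k) * ?c) * (K * F)"
        using bc 1(3) 2(3) by (simp add: algebra_simps)
      ultimately show ?thesis using exec.WhileTrue[OF True 1(1) 2(1)] 2(2) by blast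
    qed
  qed
  from this[of N s M] show ?case using While.prems by (simp add: algebra_simps)
qed

lemma init_memory_bounded:
  assumes "xs \<noteq> []"
  shows "bounded_memory (input_size xs) (input_size xs) (init_memory xs)"
proof -
  have le: "int_size z \<le> input_size xs" if "z \<in> set xs" for z
    unfolding input_size_def using that by (intro member_le_sum_list) auto
  have "1 \<le> input_size xs"
    using le[of "hd xs"] int_size_pos[of "hd xs"] assms by simp
  moreover have "\<bar>z\<bar> < 2 ^ input_size xs" if "z \<in> set xs" for z
    using less_power_int_size le[OF that] by (rule abs_lt_power_mono)
  ultimately show ?thesis by (auto simp: bounded_memory_def init_memory_def)
qed

lemma length_le_input_size: "length xs \<le> input_size xs"
  unfolding input_size_def by (induction xs) (auto simp: int_size_def)

lemma wp_imp_poly_time: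
  assumes "linear_stores c"
  shows "\<exists>p :: nat poly. \<forall>xs Q. xs \<noteq> [] \<longrightarrow> wp (input_size xs) c Q (init_memory xs) \<longrightarrow>
    (\<exists>t s. exec c (init_memory xs) t s \<and> t \<le> poly p (input_size xs) \<and> Q s)"
proof -
  \<comment> \<open>The cost bound of \<open>wp_imp_exec\<close> is the number of steps times
    \<open>K * F\<close>. Here N, L and the initial M are all the input size, written
    \<open>[:0, 1:]\<close>, while \<open>growth c\<close> and \<open>ccoeff c\<close> depend on the
    program only.\<close>
  let ?p = "step_poly c * ([:ccoeff c:] * ([:0, 1:] + [:growth c:] * [:0, 1:] * step_poly c))"
  have "\<exists>t s. exec c (init_memory xs) t s \<and> t \<le> poly ?p (input_size xs) \<and> Q s"
    if xs: "xs \<noteq> []" and wp: "wp (input_size xs) c Q (init_memory xs)" for xs Q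
    using wp_imp_exec[OF wp assms order_refl order_refl init_memory_bounded[OF xs] order_refl]
    by (auto simp: algebra_simps)
  then show ?thesis by blast
qed

section \<open>Monotone vectors and the dual bound on a forest\<close>

text \<open>The axiom \<open>anc_forest\<close> makes the ancestors of a node pairwise comparable.
  The analysis of the algorithm uses this order only, never the arcs.\<close>

locale forest_order =
  fixes anc :: "'v \<Rightarrow> 'v \<Rightarrow> bool"
  assumes anc_refl: "anc v v"
    and anc_trans: "anc u v \<Longrightarrow> anc v w \<Longrightarrow> anc u w"
    and anc_antisym: "anc u v \<Longrightarrow> anc v u \<Longrightarrow> u = v"
    and anc_forest: "anc u w \<Longrightarrow> anc v w \<Longrightarrow> anc u v \<or> anc v u"
begin

definition sub :: "'v set \<Rightarrow> 'v \<Rightarrow> 'v set" where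
  "sub A v = {w \<in> A. anc v w}"

text \<open>Stated along the whole order instead of along arcs, so that it passes to every subset of
  the nodes.\<close>

definition monotone_vec :: "'v set \<Rightarrow> ('v \<Rightarrow> real) \<Rightarrow> bool" where
  "monotone_vec A y \<longleftrightarrow> (\<forall>u\<in>A. \<forall>w\<in>A. anc u w \<longrightarrow> y u \<le> y w)"

lemma sub_subset: "sub A v \<subseteq> A"
  by (auto simp: sub_def)

lemma sub_sub: "u \<in> sub A v \<Longrightarrow> sub (sub A v) u = sub A u"
  by (auto simp: sub_def intro: anc_trans)

lemma monotone_vec_subset: "monotone_vec A y \<Longrightarrow> B \<subseteq> A \<Longrightarrow> monotone_vec B y"
  by (auto simp: monotone_vec_def)

lemma exists_top:
  assumes "finite A" "A \<noteq> {}"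
  shows "\<exists>t\<in>A. \<forall>u\<in>A. anc u t \<longrightarrow> u = t"
  using assms
proof (induction A rule: finite_ne_induct)
  case (singleton x)
  then show ?case by simp
next
  case (insert x F)
  then obtain t where t: "t \<in> F" "\<forall>u\<in>F. anc u t \<longrightarrow> u = t" by blast
  show ?case
  proof (cases "anc x t")
    case True
    have "u = x" if "u \<in> insert x F" "anc u x" for u
      using that t True anc_trans[of u x t] anc_antisym[of x u] by auto
    then show ?thesis by blast
  next
    case False
    then show ?thesis using t by auto
  qed
qed

text \<open>A monotone vector is a nonnegative combination of indicator vectors of subtrees; the
  induction peels off the contribution of a topmost node.\<close>

lemma monotone_sum_nonpos:
  assumes "finite A" and "monotone_vec A y" and "\<And>v. v \<in> A \<Longrightarrow> 0 \<le> y v"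
    and "\<And>v. v \<in> A \<Longrightarrow> sum f (sub A v) \<le> (0 :: real)"
  shows "(\<Sum>v\<in>A. f v * y v) \<le> 0"
  using assms
proof (induction "card A" arbitrary: A y)
  case 0
  have "A = {}" using 0(1,2) by simp
  then show ?case by simp
next
  case (Suc k)
  have "A \<noteq> {}" using Suc.hyps(2) by auto
  from exists_top[OF Suc.prems(1) this] obtain t where t: "t \<in> A" "\<And>u. u \<in> A \<Longrightarrow> anc u t \<Longrightarrow> u = t"
    by blast
  let ?A = "A - {t}"
  \<comment> \<open>Subtracting \<open>y t\<close> on the subtree of \<open>t\<close> splits off
    \<open>y t\<close> times the indicator of that subtree. The remainder vanishes at
    \<open>t\<close>, so it lives on \<open>A - {t}\<close>.\<close>
  define y' where "y' w = (if anc t w then y w - y t else y w)" for w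
  have sub: "sub ?A v = sub A v" if "v \<in> ?A" for v
    using that t by (auto simp: sub_def)
  have mono: "y u \<le> y w" if "u \<in> A" "w \<in> A" "anc u w" for u w
    using Suc.prems(2) that by (auto simp: monotone_vec_def)
  have "(\<Sum>v\<in>?A. f v * y' v) \<le> 0"
  proof (rule Suc.hyps(1))
    show "k = card ?A" using Suc.hyps(2) t(1) Suc.prems(1) by simp
    show "finite ?A" using Suc.prems by simp
    show "monotone_vec ?A y'"
      unfolding monotone_vec_def
    proof (intro ballI impI)
      fix u w assume *: "u \<in> ?A" "w \<in> ?A" "anc u w"
      \<comment> \<open>If \<open>t\<close> is above \<open>w\<close>, then \<open>u\<close> and
        \<open>t\<close> are comparable, and \<open>t\<close> being topmost forces it above
        \<open>u\<close>. So \<open>y t\<close> is subtracted at \<open>u\<close> exactly when it is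
        subtracted at \<open>w\<close>.\<close>
      have "anc t u" if "anc t w" using anc_forest[OF that *(3)] t(2)[of u] * by auto
      moreover have "anc t w" if "anc t u" using that * anc_trans by blast
      ultimately show "y' u \<le> y' w" using mono[of u w] * by (auto simp: y'_def)
    qed
    show "0 \<le> y' v" if "v \<in> ?A" for v
      using that Suc.prems(3)[of v] mono[of t v] t(1) by (auto simp: y'_def)
    show "sum f (sub ?A v) \<le> 0" if "v \<in> ?A" for v
      using sub[OF that] Suc.prems(4)[of v] that by simp
  qed
  moreover have "(\<Sum>v\<in>A. f v * y v) = (\<Sum>v\<in>?A. f v * y' v) + y t * sum f (sub A t)"
  proof -
    have "(\<Sum>v\<in>?A. f v * y' v) = (\<Sum>v\<in>A. f v * y' v)"
      using Suc.prems(1) by (intro sum.mono_neutral_left) (auto simp: y'_def anc_refl)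
    moreover have "y t * sum f (sub A t) = (\<Sum>v\<in>A. if anc t v then f v * y t else 0)"
      using Suc.prems(1) by (auto simp: sub_def sum_distrib_left sum.inter_filter intro!: sum.cong)
    moreover have "(\<Sum>v\<in>A. f v * y v) = (\<Sum>v\<in>A. f v * y' v) + (\<Sum>v\<in>A. if anc t v then f v * y t else 0)"
      unfolding sum.distrib[symmetric] by (rule sum.cong) (auto simp: y'_def algebra_simps)
    ultimately show ?thesis by simp
  qed
  moreover have "y t * sum f (sub A t) \<le> 0"
    using Suc.prems(3,4) t(1) by (simp add: mult_nonneg_nonpos)
  ultimately show ?case by simp
qed

text \<open>\<open>potential a b A r G\<close>: every value of the Lagrangian dual of the relaxation on the nodes \<open>A\<close>
  with budget \<open>r\<close> is at least \<open>G\<close>.\<close>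

definition potential :: "('v \<Rightarrow> real) \<Rightarrow> ('v \<Rightarrow> real) \<Rightarrow> 'v set \<Rightarrow> real \<Rightarrow> real \<Rightarrow> bool" where
  "potential a b A r G \<longleftrightarrow> (\<forall>\<rho>\<ge>0. \<exists>y. monotone_vec A y \<and> (\<forall>v\<in>A. 0 \<le> y v \<and> y v \<le> 1) \<and>
     G \<le> \<rho> * r + (\<Sum>v\<in>A. (a v - \<rho> * b v) * y v))"

text \<open>Maximal ratio of value to weight, cross-multiplied so that one definition serves the
  integers of the machine and the reals of the analysis. A weightless subtree counts as infinitely
  dense.\<close>

definition densest :: "('v \<Rightarrow> 'w :: linordered_idom) \<Rightarrow> ('v \<Rightarrow> 'w) \<Rightarrow> 'v set \<Rightarrow> 'v \<Rightarrow> bool" where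
  "densest a b A v \<longleftrightarrow> v \<in> A \<and> (sum b (sub A v) = 0 \<or>
     0 < sum b (sub A v) \<and>
     (\<forall>u\<in>A. sum a (sub A u) * sum b (sub A v) \<le> sum a (sub A v) * sum b (sub A u)))"

text \<open>Weak duality: since \<open>x\<close> fits the budget, \<open>x\<close> itself is a
  witness for every multiplier.\<close>

lemma potential_init:
  assumes "monotone_vec A x" "\<And>v. v \<in> A \<Longrightarrow> 0 \<le> x v \<and> x v \<le> 1" "(\<Sum>v\<in>A. b v * x v) \<le> r"
  shows "potential a b A r (\<Sum>v\<in>A. a v * x v)"
  unfolding potential_def
proof (intro allI impI exI conjI)
  fix \<rho> :: real assume "0 \<le> \<rho>"
  then have "\<rho> * (\<Sum>v\<in>A. b v * x v) \<le> \<rho> * r" using assms by (simp add: mult_left_mono)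
  then show "(\<Sum>v\<in>A. a v * x v) \<le> \<rho> * r + (\<Sum>v\<in>A. (a v - \<rho> * b v) * x v)"
    by (simp add: algebra_simps sum_subtractf sum_distrib_left)
qed (use assms in auto)

text \<open>The multiplier 0 removes the budget term and leaves an empty sum.\<close>

lemma potential_empty: "potential a b {} r G \<Longrightarrow> G \<le> 0"
  unfolding potential_def by force

text \<open>With the largest density as multiplier no subtree is profitable; this supplies the
  premise of \<open>monotone_sum_nonpos\<close>.\<close>

lemma densest_reduced_value:
  assumes "densest a b A v" and "u \<in> A" and "0 < sum b (sub A v)"
    and "\<rho> = sum a (sub A v) / sum b (sub A v)"
  shows "sum (\<lambda>w. a w - \<rho> * b w) (sub A u) \<le> (0 :: real)"
proof -
  have "sum a (sub A u) * sum b (sub A v) \<le> sum a (sub A v) * sum b (sub A u)"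
    using assms by (auto simp: densest_def)
  then have "sum a (sub A u) \<le> \<rho> * sum b (sub A u)"
    using assms(3,4) by (simp add: pos_le_divide_eq)
  then show ?thesis by (simp add: sum_subtractf sum_distrib_left)
qed

text \<open>At this multiplier the zero vector is optimal among the admissible ones, so the dual
  value is just the budget term.\<close>

lemma potential_at_density:
  assumes "finite A" and "densest a b A v" and "0 < sum b (sub A v)"
    and "\<And>w. w \<in> A \<Longrightarrow> 0 \<le> a w"
    and "\<rho> = sum a (sub A v) / sum b (sub A v)" and "potential a b A r G"
  shows "G \<le> \<rho> * r"
proof -
  have "0 \<le> sum a (sub A v)" using assms(4) sub_subset by (intro sum_nonneg) blast
  then have "0 \<le> \<rho>" using assms by simp
  then obtain y where y: "monotone_vec A y" "\<forall>v\<in>A. 0 \<le> y v \<and> y v \<le> 1"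
    "G \<le> \<rho> * r + (\<Sum>v\<in>A. (a v - \<rho> * b v) * y v)"
    using assms(6) unfolding potential_def by blast
  have "(\<Sum>v\<in>A. (a v - \<rho> * b v) * y v) \<le> 0"
    using densest_reduced_value[OF assms(2) _ assms(3,5)] y assms(1)
    by (intro monotone_sum_nonpos) auto
  then show ?thesis using y by simp
qed

text \<open>Let \<sigma> be the density of the subtree R. For multipliers up to \<sigma>, or for
  weightless R, the all-ones vector is best on R, so restricting the old witness to the other nodes
  loses at most the reduced value of R. Above \<sigma> the zero vector suffices, by the dual bound
  at \<sigma>.\<close>

lemma potential_take:
  assumes "finite A" and dens: "densest a b A v"
    and nn: "\<And>w. w \<in> A \<Longrightarrow> 0 \<le> a w" "\<And>w. w \<in> A \<Longrightarrow> 0 \<le> b w"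
    and pot: "potential a b A r G" and fits: "sum b (sub A v) \<le> r"
  shows "potential a b (A - sub A v) (r - sum b (sub A v)) (G - sum a (sub A v))"
  unfolding potential_def
proof (intro allI impI)
  let ?R = "sub A v"
  let ?thesis_at = "\<lambda>\<rho>. \<exists>y. monotone_vec (A - ?R) y \<and> (\<forall>v\<in>A - ?R. 0 \<le> y v \<and> y v \<le> 1) \<and>
        G - sum a ?R \<le> \<rho> * (r - sum b ?R) + (\<Sum>v\<in>A - ?R. (a v - \<rho> * b v) * y v)"
  have finR: "finite ?R" using assms(1) sub_subset finite_subset by blast
  fix \<rho> :: real assume \<rho>: "0 \<le> \<rho>"
  \<comment> \<open>Reduces the goal at \<rho> to one inequality: on \<open>?R\<close> no admissible
    vector beats all ones.\<close>
  have restrict: "?thesis_at \<rho>"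
    if "\<And>y. monotone_vec A y \<Longrightarrow> \<forall>v\<in>A. 0 \<le> y v \<and> y v \<le> 1 \<Longrightarrow>
       (\<Sum>v\<in>?R. (a v - \<rho> * b v) * y v) \<le> (\<Sum>v\<in>?R. a v - \<rho> * b v)"
  proof -
    obtain y where y: "monotone_vec A y" "\<forall>v\<in>A. 0 \<le> y v \<and> y v \<le> 1"
      "G \<le> \<rho> * r + (\<Sum>v\<in>A. (a v - \<rho> * b v) * y v)"
      using pot \<rho> unfolding potential_def by blast
    have "(\<Sum>v\<in>A. (a v - \<rho> * b v) * y v) =
       (\<Sum>v\<in>A - ?R. (a v - \<rho> * b v) * y v) + (\<Sum>v\<in>?R. (a v - \<rho> * b v) * y v)"
      by (rule sum.subset_diff[OF sub_subset assms(1)])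
    with that[OF y(1,2)] y(3)
    have "G - sum a ?R \<le> \<rho> * (r - sum b ?R) + (\<Sum>v\<in>A - ?R. (a v - \<rho> * b v) * y v)"
      by (simp add: sum_subtractf sum_distrib_left[symmetric] right_diff_distrib)
    then show ?thesis using y monotone_vec_subset by blast
  qed
  show "?thesis_at \<rho>"
  proof (cases "sum b ?R = 0")
    case True
    \<comment> \<open>Nonnegative weights with sum 0 all vanish, so the reduced values on
      \<open>?R\<close> are the values themselves and all ones is best.\<close>
    then have b0: "b w = 0" if "w \<in> ?R" for w
      using that nn(2) sub_subset finR sum_nonneg_eq_0_iff[of ?R b] by blast
    show ?thesis
    proof (rule restrict, rule sum_mono)
      fix y w assume "\<forall>v\<in>A. 0 \<le> y v \<and> y v \<le> (1 :: real)" "w \<in> ?R"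
      then show "(a w - \<rho> * b w) * y w \<le> a w - \<rho> * b w"
        using b0 nn(1)[of w] subsetD[OF sub_subset, of w A v] by (auto intro!: mult_left_le)
    qed
  next
    case False
    then have pos: "0 < sum b ?R" using dens by (auto simp: densest_def)
    define \<sigma> where "\<sigma> = sum a ?R / sum b ?R"
    show ?thesis
    proof (cases "\<rho> \<le> \<sigma>")
      case True
      show ?thesis
      proof (rule restrict)
        fix y :: "'v \<Rightarrow> real" assume y: "monotone_vec A y" "\<forall>v\<in>A. 0 \<le> y v \<and> y v \<le> 1"
        have yR: "0 \<le> y w \<and> y w \<le> 1" if "w \<in> ?R" for w using y that sub_subset by blast
        \<comment> \<open>The reduced value at \<rho> is split as (a - \<sigma> b) + (\<sigma> -
          \<rho>) b. The first part is at most 0 on monotone vectors and equals 0 at all ones; the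
          second has nonnegative coefficients, so all ones maximizes it.\<close>
        have "(\<Sum>w\<in>?R. (a w - \<sigma> * b w) * y w) \<le> 0"
        proof (rule monotone_sum_nonpos[OF finR])
          show "monotone_vec ?R y" using y sub_subset monotone_vec_subset by blast
          show "0 \<le> y w" if "w \<in> ?R" for w using yR that by blast
          show "sum (\<lambda>w. a w - \<sigma> * b w) (sub ?R u) \<le> 0" if "u \<in> ?R" for u
            using densest_reduced_value[OF dens _ pos \<sigma>_def] sub_sub[OF that] that sub_subset
            by (metis subsetD)
        qed
        moreover have "(\<Sum>w\<in>?R. (\<sigma> - \<rho>) * b w * y w) \<le> (\<Sum>w\<in>?R. (\<sigma> - \<rho>) * b w)"
        proof (rule sum_mono)
          fix w assume "w \<in> ?R"
          then show "(\<sigma> - \<rho>) * b w * y w \<le> (\<sigma> - \<rho>) * b w"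
            using yR[of w] nn(2)[of w] True subsetD[OF sub_subset, of w A v]
            by (intro mult_left_le) auto
        qed
        moreover have "(\<Sum>w\<in>?R. (a w - \<rho> * b w) * y w) =
           (\<Sum>w\<in>?R. (a w - \<sigma> * b w) * y w) + (\<Sum>w\<in>?R. (\<sigma> - \<rho>) * b w * y w)"
          unfolding sum.distrib[symmetric] by (rule sum.cong) (auto simp: algebra_simps)
        moreover have "(\<Sum>w\<in>?R. (\<sigma> - \<rho>) * b w) = (\<Sum>w\<in>?R. a w - \<rho> * b w)"
        proof -
          have "\<sigma> * sum b ?R = sum a ?R" using pos by (simp add: \<sigma>_def)
          then show ?thesis
            unfolding sum_subtractf sum_distrib_left[symmetric] by (simp add: left_diff_distrib)
        qed
        ultimately show "(\<Sum>w\<in>?R. (a w - \<rho> * b w) * y w) \<le> (\<Sum>w\<in>?R. a w - \<rho> * b w)"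
          by linarith
      qed
    next
      case False
      \<comment> \<open>Because R fits, the remaining budget is nonnegative, and raising the
        multiplier from \<sigma> to \<rho> only increases the budget term.\<close>
      have "G \<le> \<sigma> * r" using potential_at_density[OF assms(1) dens pos nn(1) \<sigma>_def pot] .
      moreover have "\<sigma> * sum b ?R = sum a ?R" using pos by (simp add: \<sigma>_def)
      ultimately have "G - sum a ?R \<le> \<sigma> * (r - sum b ?R)" by (simp add: right_diff_distrib)
      also have "\<dots> \<le> \<rho> * (r - sum b ?R)" using False fits by (intro mult_right_mono) auto
      finally show ?thesis by (intro exI[of _ "\<lambda>_. 0"]) (auto simp: monotone_vec_def)
    qed
  qed
qed

text \<open>The dual bound at the density of the subtree R says that G is at most the value of the
  fraction \<theta> of R that exactly exhausts the budget. Hence the nodes outside R can be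
  abandoned at no loss, and giving up \<open>v\<close> costs at most its full value. The constant
  vector \<theta> is then a witness for every multiplier.\<close>

lemma potential_drop:
  assumes "finite A" and dens: "densest a b A v"
    and nn: "\<And>w. w \<in> A \<Longrightarrow> 0 \<le> a w" "\<And>w. w \<in> A \<Longrightarrow> 0 \<le> b w"
    and pot: "potential a b A r G" and r: "0 \<le> r" "r < sum b (sub A v)"
  shows "potential a b (sub A v - {v}) r (G - a v)"
  unfolding potential_def
proof (intro allI impI)
  let ?R = "sub A v"
  fix \<rho> :: real assume \<rho>: "0 \<le> \<rho>"
  have pos: "0 < sum b ?R" using r by simp
  have v: "v \<in> ?R" "v \<in> A" using dens by (auto simp: densest_def sub_def anc_refl)
  have finR: "finite ?R" using assms(1) sub_subset finite_subset by blast
  define \<theta> where "\<theta> = r / sum b ?R"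
  have \<theta>: "0 \<le> \<theta>" "\<theta> \<le> 1" using r pos by (auto simp: \<theta>_def)
  have a: "sum a ?R = a v + sum a (?R - {v})" and b: "sum b ?R = b v + sum b (?R - {v})"
    using v finR by (auto simp: sum.remove)
  have "G \<le> sum a ?R / sum b ?R * r"
    using potential_at_density[OF assms(1) dens pos nn(1) refl pot] .
  also have "\<dots> = \<theta> * a v + \<theta> * sum a (?R - {v})"
    unfolding distrib_left[symmetric] a[symmetric] by (simp add: \<theta>_def)
  also have "\<theta> * a v \<le> a v" using \<theta> nn(1)[OF v(2)] by (simp add: mult_left_le_one_le)
  finally have "G - a v \<le> \<theta> * sum a (?R - {v})" by simp
  moreover have "\<theta> * sum b (?R - {v}) \<le> r"
  proof -
    have "\<theta> * sum b (?R - {v}) \<le> \<theta> * sum b ?R"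
      using \<theta> nn(2)[OF v(2)] b by (intro mult_left_mono) auto
    also have "\<dots> = r" using pos by (simp add: \<theta>_def)
    finally show ?thesis .
  qed
  then have "\<rho> * (\<theta> * sum b (?R - {v})) \<le> \<rho> * r" using \<rho> by (rule mult_left_mono)
  moreover have "(\<Sum>w\<in>?R - {v}. (a w - \<rho> * b w) * \<theta>) =
      \<theta> * sum a (?R - {v}) - \<rho> * (\<theta> * sum b (?R - {v}))"
    unfolding sum_distrib_left sum_subtractf[symmetric]
    by (rule sum.cong) (auto simp: algebra_simps)
  ultimately have "G - a v \<le> \<rho> * r + (\<Sum>w\<in>?R - {v}. (a w - \<rho> * b w) * \<theta>)" by linarith
  then show "\<exists>y. monotone_vec (?R - {v}) y \<and> (\<forall>w\<in>?R - {v}. 0 \<le> y w \<and> y w \<le> 1) \<and>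
     G - a v \<le> \<rho> * r + (\<Sum>w\<in>?R - {v}. (a w - \<rho> * b w) * y w)"
    using \<theta> by (intro exI[of _ "\<lambda>_. \<theta>"]) (auto simp: monotone_vec_def)
qed

section \<open>The invariant of the greedy procedure\<close>

definition chain :: "'v set \<Rightarrow> bool" where
  "chain C \<longleftrightarrow> (\<forall>u\<in>C. \<forall>v\<in>C. anc u v \<or> anc v u)"

text \<open>The chain C of nodes given up is only asserted to exist. It lies strictly above all
  active nodes, so any active node extends it. The bound is stated for every feasible x, which
  avoids speaking of an optimal solution. The closure condition on \<open>A\<close> keeps
  \<open>S\<close> closed under descendants when an active subtree joins it.\<close>

definition greedy_inv :: "('v \<Rightarrow> real) \<Rightarrow> ('v \<Rightarrow> real) \<Rightarrow> 'v set \<Rightarrow> real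
    \<Rightarrow> 'v set \<Rightarrow> 'v set \<Rightarrow> real \<Rightarrow> bool" where
  "greedy_inv a b N B A S r \<longleftrightarrow> A \<subseteq> N \<and> S \<subseteq> N \<and> A \<inter> S = {} \<and>
     (\<forall>u\<in>A. \<forall>w\<in>N. anc u w \<longrightarrow> w \<in> A \<union> S) \<and> (\<forall>u\<in>S. \<forall>w\<in>N. anc u w \<longrightarrow> w \<in> S) \<and>
     0 \<le> r \<and> sum b S + r = B \<and>
     (\<exists>C \<subseteq> N. chain C \<and> (\<forall>c\<in>C. \<forall>v\<in>A. c \<noteq> v \<and> anc c v) \<and>
       (\<forall>x. monotone_vec N x \<longrightarrow> (\<forall>v\<in>N. 0 \<le> x v \<and> x v \<le> 1) \<longrightarrow> (\<Sum>v\<in>N. b v * x v) \<le> B \<longrightarrow>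
          potential a b A r ((\<Sum>v\<in>N. a v * x v) - sum a C - sum a S)))"

lemma greedy_inv_init:
  "0 \<le> B \<Longrightarrow> greedy_inv a b N B N {} B"
  unfolding greedy_inv_def
  by (auto simp: chain_def intro!: exI[of _ "{}"] potential_init)

lemma greedy_inv_take:
  assumes "finite N" and inv: "greedy_inv a b N B A S r" and dens: "densest a b A v"
    and nn: "\<And>w. w \<in> N \<Longrightarrow> 0 \<le> a w" "\<And>w. w \<in> N \<Longrightarrow> 0 \<le> b w"
    and fits: "sum b (sub A v) \<le> r"
  shows "greedy_inv a b N B (A - sub A v) (S \<union> sub A v) (r - sum b (sub A v))"
proof -
  let ?R = "sub A v"
  have AN: "A \<subseteq> N" "S \<subseteq> N" "A \<inter> S = {}" using inv by (auto simp: greedy_inv_def)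
  have fin: "finite A" "finite S" "finite ?R"
    using AN assms(1) sub_subset by (meson finite_subset)+
  have disj: "S \<inter> ?R = {}" using AN sub_subset by blast
  have "v \<in> A" using dens by (simp add: densest_def)
  have sums: "sum f (S \<union> ?R) = sum f S + sum f ?R" for f :: "'v \<Rightarrow> real"
    using fin disj by (intro sum.union_disjoint)
  obtain C where C: "C \<subseteq> N" "chain C" "\<forall>c\<in>C. \<forall>v\<in>A. c \<noteq> v \<and> anc c v"
    and pot: "\<And>x. monotone_vec N x \<Longrightarrow> \<forall>v\<in>N. 0 \<le> x v \<and> x v \<le> 1 \<Longrightarrow> (\<Sum>v\<in>N. b v * x v) \<le> B \<Longrightarrow>
          potential a b A r ((\<Sum>v\<in>N. a v * x v) - sum a C - sum a S)"
    using inv unfolding greedy_inv_def by auto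
  have pot': "potential a b (A - ?R) (r - sum b ?R) ((\<Sum>v\<in>N. a v * x v) - sum a C - sum a (S \<union> ?R))"
    if "monotone_vec N x" "\<forall>v\<in>N. 0 \<le> x v \<and> x v \<le> 1" "(\<Sum>v\<in>N. b v * x v) \<le> B" for x
    using potential_take[OF fin(1) dens _ _ pot[OF that] fits] nn AN
    by (auto simp: sums algebra_simps)
  have clA: "\<forall>u\<in>A - ?R. \<forall>w\<in>N. anc u w \<longrightarrow> w \<in> (A - ?R) \<union> (S \<union> ?R)"
    using inv by (auto simp: greedy_inv_def)
  have clS: "\<forall>u\<in>S \<union> ?R. \<forall>w\<in>N. anc u w \<longrightarrow> w \<in> S \<union> ?R"
  proof (intro ballI impI)
    fix u w assume *: "u \<in> S \<union> ?R" "w \<in> N" "anc u w"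
    show "w \<in> S \<union> ?R"
    proof (cases "u \<in> S")
      case True
      then show ?thesis using * inv by (auto simp: greedy_inv_def)
    next
      case False
      then have "u \<in> A" "anc v w" using * anc_trans by (auto simp: sub_def)
      then show ?thesis using * inv by (auto simp: greedy_inv_def sub_def)
    qed
  qed
  have "sum b (S \<union> ?R) + (r - sum b ?R) = B" using inv by (auto simp: sums greedy_inv_def)
  moreover have "\<exists>C \<subseteq> N. chain C \<and> (\<forall>c\<in>C. \<forall>v\<in>A - ?R. c \<noteq> v \<and> anc c v) \<and>
       (\<forall>x. monotone_vec N x \<longrightarrow> (\<forall>v\<in>N. 0 \<le> x v \<and> x v \<le> 1) \<longrightarrow> (\<Sum>v\<in>N. b v * x v) \<le> B \<longrightarrow>
          potential a b (A - ?R) (r - sum b ?R) ((\<Sum>v\<in>N. a v * x v) - sum a C - sum a (S \<union> ?R)))"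
    using C pot' by (intro exI[of _ C]) auto
  moreover have "A - ?R \<subseteq> N" "S \<union> ?R \<subseteq> N" "(A - ?R) \<inter> (S \<union> ?R) = {}" "0 \<le> r - sum b ?R"
    using AN fits sub_subset[of A v] by auto
  ultimately show ?thesis unfolding greedy_inv_def using clA clS by blast
qed

lemma greedy_inv_drop:
  assumes "finite N" and inv: "greedy_inv a b N B A S r" and dens: "densest a b A v"
    and nn: "\<And>w. w \<in> N \<Longrightarrow> 0 \<le> a w" "\<And>w. w \<in> N \<Longrightarrow> 0 \<le> b w"
    and misfit: "r < sum b (sub A v)"
  shows "greedy_inv a b N B (sub A v - {v}) S r"
proof -
  let ?R = "sub A v"
  have AN: "A \<subseteq> N" "S \<subseteq> N" "A \<inter> S = {}" "0 \<le> r" using inv by (auto simp: greedy_inv_def)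
  have fin: "finite A" using AN assms(1) by (auto intro: finite_subset)
  have vA: "v \<in> A" using dens by (simp add: densest_def)
  obtain C where C: "C \<subseteq> N" "chain C" "\<forall>c\<in>C. \<forall>v\<in>A. c \<noteq> v \<and> anc c v"
    and pot: "\<And>x. monotone_vec N x \<Longrightarrow> \<forall>v\<in>N. 0 \<le> x v \<and> x v \<le> 1 \<Longrightarrow> (\<Sum>v\<in>N. b v * x v) \<le> B \<Longrightarrow>
          potential a b A r ((\<Sum>v\<in>N. a v * x v) - sum a C - sum a S)"
    using inv unfolding greedy_inv_def by auto
  \<comment> \<open>Members of C differ from every active node, so v is new and its value is counted
    once.\<close>
  have "v \<notin> C" "finite C" using C vA assms(1) by (auto intro: finite_subset)
  then have sumC: "sum a (insert v C) = a v + sum a C" by simp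
  have pot': "potential a b (?R - {v}) r ((\<Sum>v\<in>N. a v * x v) - sum a (insert v C) - sum a S)"
    if "monotone_vec N x" "\<forall>v\<in>N. 0 \<le> x v \<and> x v \<le> 1" "(\<Sum>v\<in>N. b v * x v) \<le> B" for x
    using potential_drop[OF fin dens _ _ pot[OF that] AN(4) misfit] nn AN
    by (auto simp: sumC algebra_simps)
  have "chain (insert v C)" using C vA by (auto simp: chain_def anc_refl)
  moreover have "\<forall>c\<in>insert v C. \<forall>w\<in>?R - {v}. c \<noteq> w \<and> anc c w"
    using C by (auto simp: sub_def)
  ultimately have "\<exists>C \<subseteq> N. chain C \<and> (\<forall>c\<in>C. \<forall>w\<in>?R - {v}. c \<noteq> w \<and> anc c w) \<and>
       (\<forall>x. monotone_vec N x \<longrightarrow> (\<forall>v\<in>N. 0 \<le> x v \<and> x v \<le> 1) \<longrightarrow> (\<Sum>v\<in>N. b v * x v) \<le> B \<longrightarrow>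
          potential a b (?R - {v}) r ((\<Sum>v\<in>N. a v * x v) - sum a C - sum a S))"
    using C(1) vA AN pot' by (intro exI[of _ "insert v C"]) auto
  moreover have "\<forall>u\<in>?R - {v}. \<forall>w\<in>N. anc u w \<longrightarrow> w \<in> (?R - {v}) \<union> S"
  proof (intro ballI impI)
    fix u w assume *: "u \<in> ?R - {v}" "w \<in> N" "anc u w"
    then have u: "u \<in> A" "anc v u" "u \<noteq> v" by (auto simp: sub_def)
    then have "w \<in> A \<union> S" using inv * by (auto simp: greedy_inv_def)
    moreover have "anc v w" using anc_trans[OF u(2) *(3)] .
    moreover have "w \<noteq> v" using anc_antisym[OF u(2)] * u(3) by blast
    ultimately have "w \<in> A \<union> S" "anc v w" "w \<noteq> v" by blast+
    then show "w \<in> (?R - {v}) \<union> S" by (auto simp: sub_def)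
  qed
  moreover have "?R - {v} \<subseteq> N" "(?R - {v}) \<inter> S = {}" using AN sub_subset by blast+
  ultimately show ?thesis using inv unfolding greedy_inv_def by auto
qed

end

section \<open>The tree of an instance and its encoding\<close>

text \<open>Induction along the path from the root. No arc enters the root, and since parents are
  unique, a cycle through a node also passes through its parent.\<close>

lemma rooted_tree_acyclic:
  assumes "rooted_tree r N A"
  shows "(v, v) \<notin> A\<^sup>+"
proof
  assume cyc: "(v, v) \<in> A\<^sup>+"
  have sub: "A \<subseteq> insert r N \<times> N" and "r \<notin> N" using assms by (auto simp: rooted_tree_def)
  have uniq: "u = u'" if "(u, w) \<in> A" "(u', w) \<in> A" for u u' w
    using assms sub that unfolding rooted_tree_def by blast
  have "v \<in> N" using cyc sub by (auto elim: tranclE)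
  then have "(r, v) \<in> A\<^sup>*" using assms by (auto simp: rooted_tree_def)
  then have "(v, v) \<notin> A\<^sup>+"
  proof (induction rule: rtrancl_induct)
    case base
    then show ?case using sub \<open>r \<notin> N\<close> by (auto elim: tranclE)
  next
    case (step u w)
    show ?case
    proof
      assume "(w, w) \<in> A\<^sup>+"
      then obtain u' where "(w, u') \<in> A\<^sup>*" "(u', w) \<in> A"
        by (meson tranclD2)
      then have "(w, u) \<in> A\<^sup>*" using uniq step.hyps by blast
      with step.hyps(2) have "(u, u) \<in> A\<^sup>+" by (rule rtrancl_into_trancl2)
      then show False using step.IH by blast
    qed
  qed
  then show False using cyc by blast
qed

text \<open>Unique parents make the converse of the arc relation single-valued, hence confluent in
  the strong sense that two ancestors of a node are comparable.\<close>

lemma rooted_tree_forest_order: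
  assumes "rooted_tree r N A"
  shows "forest_order (\<lambda>u v. (u, v) \<in> A\<^sup>*)"
proof
  have sub: "A \<subseteq> insert r N \<times> N" using assms by (auto simp: rooted_tree_def)
  have "single_valued (A\<inverse>)"
    using assms sub unfolding rooted_tree_def single_valued_def by blast
  from single_valued_confluent[OF this]
  show "(u, v) \<in> A\<^sup>* \<or> (v, u) \<in> A\<^sup>*" if "(u, w) \<in> A\<^sup>*" "(v, w) \<in> A\<^sup>*" for u v w
    using that by (auto simp: rtrancl_converse)
  show "u = v" if "(u, v) \<in> A\<^sup>*" "(v, u) \<in> A\<^sup>*" for u v
    using that rooted_tree_acyclic[OF assms, of u] by (metis rtranclD rtrancl_trancl_trancl)
qed auto

lemma nth_concat_blocks:
  assumes "\<And>x. x \<in> set xs \<Longrightarrow> length (f x) = m" and "k < length xs" and "j < m"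
  shows "concat (map f xs) ! (m * k + j) = f (xs ! k) ! j"
  using assms
proof (induction xs arbitrary: k)
  case (Cons x xs)
  then show ?case by (cases k) (auto simp: nth_append)
qed simp

lemma quotient_of_split: "q = of_int (fst (quotient_of q)) / of_int (snd (quotient_of q))"
  by (cases "quotient_of q") (simp add: quotient_of_div)

section \<open>The program\<close>

text \<open>The record of node \<open>v\<close> occupies the input cells \<open>5 * v - 2\<close> (parent), \<open>5 * v - 1\<close> and
  \<open>5 * v\<close> (value), \<open>5 * v + 1\<close> and \<open>5 * v + 2\<close> (weight).\<close>

definition field :: "string \<Rightarrow> int \<Rightarrow> aexp" where
  "field X k = Cell ''in'' (Add (Mul (Const 5) (reg X)) (Const k))"

abbreviation eqb :: "aexp \<Rightarrow> aexp \<Rightarrow> bexp" where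
  "eqb a b \<equiv> And (Not (Less a b)) (Not (Less b a))"

text \<open>A common multiple of all denominators. Every factor besides \<open>d\<close> is read
  from \<open>in\<close>, which keeps the degree of the store at 1.\<close>

definition denominators :: com where
  "denominators = Seq (set_reg ''d'' (Cell ''in'' (Const 2)))
     (for_nodes ''i'' (set_reg ''d'' (Mul (Mul (reg ''d'') (field ''i'' 0)) (field ''i'' 2))))"

text \<open>Multiplying all data by one positive factor preserves feasibility and all comparisons of
  densities. The divisions are exact.\<close>

definition scale :: com where
  "scale = Seq (set_reg ''r'' (Mul (Cell ''in'' (Const 1)) (Div (reg ''d'') (Cell ''in'' (Const 2)))))
     (for_nodes ''i'' (Seq (Store ''a'' (reg ''i'') (Mul (field ''i'' (-1)) (Div (reg ''d'') (field ''i'' 0))))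
       (Seq (Store ''b'' (reg ''i'') (Mul (field ''i'' 1) (Div (reg ''d'') (field ''i'' 2))))
         (Store ''act'' (reg ''i'') (Const 1)))))"

text \<open>Subtree membership test: climbing from \<open>w\<close> ends at \<open>v\<close> if
  \<open>w\<close> lies below or at \<open>v\<close>, and at the root 0 otherwise.\<close>

definition walk :: com where
  "walk = Seq (set_reg ''u'' (reg ''w''))
     (While (And (Less (Const 0) (reg ''u'')) (Not (eqb (reg ''u'') (reg ''v''))))
       (set_reg ''u'' (field ''u'' (-2))))"

definition for_active :: "com \<Rightarrow> com" where
  "for_active c = for_nodes ''w'' (If (Less (Const 0) (Cell ''act'' (reg ''w''))) (Seq walk c) Skip)"

definition subtree_sums :: com where
  "subtree_sums = Seq (set_reg ''sa'' (Const 0)) (Seq (set_reg ''sb'' (Const 0))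
     (for_active (If (eqb (reg ''u'') (reg ''v''))
       (Seq (set_reg ''sa'' (Add (reg ''sa'') (Cell ''a'' (reg ''w''))))
            (set_reg ''sb'' (Add (reg ''sb'') (Cell ''b'' (reg ''w'')))))
       Skip)))"

text \<open>Densities are compared by cross-multiplication. A subtree of weight \<open>0\<close> always replaces the
  current best, since \<open>0 / 0\<close> would compare equal to everything; the initial pair \<open>(-1, 1)\<close> loses
  against every subtree.\<close>

definition scan :: com where
  "scan = Seq (set_reg ''best'' (Const 0)) (Seq (set_reg ''besta'' (Const (-1)))
     (Seq (set_reg ''bestb'' (Const 1))
     (for_nodes ''v'' (If (Less (Const 0) (Cell ''act'' (reg ''v'')))
       (Seq subtree_sums
         (If (And (Less (Const 0) (reg ''sb''))
               (Not (Less (Mul (reg ''sb'') (reg ''besta'')) (Mul (reg ''sa'') (reg ''bestb'')))))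
           Skip
           (Seq (set_reg ''best'' (reg ''v''))
             (Seq (set_reg ''besta'' (reg ''sa'')) (set_reg ''bestb'' (reg ''sb''))))))
       Skip))))"

definition take_subtree :: com where
  "take_subtree = Seq (set_reg ''r'' (Sub (reg ''r'') (reg ''bestb'')))
     (for_active (If (eqb (reg ''u'') (reg ''v''))
       (Seq (Store ''out'' (reg ''w'') (Const 1)) (Store ''act'' (reg ''w'') (Const 0)))
       Skip))"

text \<open>Everything outside the subtree of \<open>v\<close> is discarded too, which
  \<open>potential_drop\<close> permits at no loss.\<close>

definition drop_node :: com where
  "drop_node = Seq
     (for_active (If (eqb (reg ''u'') (reg ''v'')) Skip (Store ''act'' (reg ''w'') (Const 0))))
     (Store ''act'' (reg ''v'') (Const 0))"

text \<open>The root's number 0 in \<open>best\<close> signals that no active node is left; such a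
  round is idle.\<close>

definition greedy_step :: com where
  "greedy_step = Seq scan (If (Less (Const 0) (reg ''best''))
     (Seq (set_reg ''v'' (reg ''best''))
       (If (Less (reg ''r'') (reg ''bestb'')) drop_node take_subtree))
     Skip)"

definition tk_program :: com where
  "tk_program = Seq denominators (Seq scale (for_nodes ''k'' greedy_step))"

lemma writes_program [simp]:
  "writes denominators = {''d'', ''i''}"
  "writes scale = {''r'', ''i'', ''a'', ''b'', ''act''}"
  "writes walk = {''u''}"
  "writes (for_active c) = {''w'', ''u''} \<union> writes c"
  "writes subtree_sums = {''sa'', ''sb'', ''w'', ''u''}"
  "writes scan = {''best'', ''besta'', ''bestb'', ''v'', ''sa'', ''sb'', ''w'', ''u''}"
  "writes take_subtree = {''r'', ''w'', ''u'', ''out'', ''act''}"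
  "writes drop_node = {''w'', ''u'', ''act''}"
  "writes greedy_step = {''best'', ''besta'', ''bestb'', ''v'', ''sa'', ''sb'', ''w'', ''u'',
     ''r'', ''out'', ''act''}"
  by (auto simp: denominators_def scale_def walk_def for_active_def subtree_sums_def scan_def
      take_subtree_def drop_node_def greedy_step_def)

lemma linear_stores_program: "linear_stores tk_program"
  by (simp add: tk_program_def denominators_def scale_def greedy_step_def scan_def subtree_sums_def
      take_subtree_def drop_node_def for_active_def walk_def for_nodes_def field_def)

section \<open>Correctness of the program\<close>

text \<open>T is the iteration bound handed to \<open>wp\<close>. It is kept apart from the number
  of nodes so that it can be instantiated with the input size.\<close>

locale knapsack_run =
  fixes I :: "nat tree_knapsack" and T :: nat
  assumes inst: "tk_instance I" and num: "numbered I" and T: "card (nodes I) \<le> T"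
begin

section \<open>The tree order and the layout of the input\<close>

definition n :: nat where "n = card (nodes I)"

definition anc :: "nat \<Rightarrow> nat \<Rightarrow> bool" where "anc u v \<longleftrightarrow> (u, v) \<in> (arcs I)\<^sup>*"

definition inp :: "int \<Rightarrow> int" where "inp = init_memory (encode I) ''in''"

lemma tree: "rooted_tree 0 (nodes I) (arcs I)"
  using inst num by (simp add: tk_instance_def numbered_def)

lemma nodes_eq: "nodes I = {1..n}"
  using num by (simp add: numbered_def n_def)

sublocale forest_order anc
  using rooted_tree_forest_order[OF tree] by (simp add: anc_def[abs_def])

lemma finite_nodes: "finite (nodes I)"
  by (simp add: nodes_eq)

lemma arcs_iff: "(u, v) \<in> arcs I \<longleftrightarrow> v \<in> nodes I \<and> u = parent I v"
proof -
  have ex1: "\<exists>!u. (u, v) \<in> arcs I" if "v \<in> nodes I" for v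
    using tree that by (auto simp: rooted_tree_def)
  have "(parent I v, v) \<in> arcs I" if "v \<in> nodes I"
    unfolding parent_def using ex1[OF that] by (rule theI')
  moreover have "v \<in> nodes I" if "(u, v) \<in> arcs I" using tree that by (auto simp: rooted_tree_def)
  ultimately show ?thesis using ex1 by blast
qed

lemma parent_le: "v \<in> nodes I \<Longrightarrow> parent I v \<le> n"
  using arcs_iff[of "parent I v" v] tree by (auto simp: rooted_tree_def nodes_eq)

lemma anc_parent_iff:
  assumes "v \<in> nodes I"
  shows "anc u v \<longleftrightarrow> u = v \<or> anc u (parent I v)"
proof
  assume "anc u v"
  then show "u = v \<or> anc u (parent I v)"
    unfolding anc_def by (cases rule: rtranclE) (auto simp: arcs_iff)
next
  assume "u = v \<or> anc u (parent I v)"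
  then show "anc u v"
    using assms arcs_iff[of "parent I v" v] by (auto simp: anc_def intro: rtrancl_into_rtrancl)
qed

lemma not_anc_parent:
  assumes "v \<in> nodes I"
  shows "\<not> anc v (parent I v)"
proof
  assume "anc v (parent I v)"
  then have "(v, v) \<in> (arcs I)\<^sup>+"
    using assms arcs_iff[of "parent I v" v] by (auto simp: anc_def intro: rtrancl_into_trancl1)
  then show False using rooted_tree_acyclic[OF tree] by blast
qed

lemma anc_zero: "anc u 0 \<longleftrightarrow> u = 0"
  unfolding anc_def by (auto elim: rtranclE simp: arcs_iff nodes_eq)

text \<open>Termination measure for climbing to the root. As nodes are numbered in no particular
  order, the number of a node could not serve.\<close>

definition depth :: "nat \<Rightarrow> nat" where "depth v = card {u \<in> nodes I. anc u v}"

lemma depth_le: "depth v \<le> n"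
  unfolding depth_def n_def by (intro card_mono finite_nodes) auto

lemma depth_parent: "v \<in> nodes I \<Longrightarrow> depth (parent I v) < depth v"
  unfolding depth_def using not_anc_parent anc_parent_iff
  by (intro psubset_card_mono) (auto simp: finite_nodes anc_refl)

lemma encode_length: "length (encode I) = 3 + 5 * n"
proof -
  have "length (concat (map (\<lambda>v. int (parent I v) # encode_rat (val I v) @ encode_rat (wgt I v)) xs))
      = 5 * length xs" for xs
    by (induction xs) (auto simp: encode_rat_def)
  from this[of "[1..<n + 1]"] show ?thesis
    unfolding encode_def n_def[symmetric] by (simp add: encode_rat_def del: upt_Suc map_upt_Suc)
qed

lemma inp_head: "inp 0 = int n" "inp 1 = fst (quotient_of (budget I))"
    "inp 2 = snd (quotient_of (budget I))"
  using encode_length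
  by (auto simp: inp_def init_memory_def encode_def encode_rat_def n_def nth_Cons' nat_numeral)

lemma inp_block:
  assumes "v \<in> nodes I" "j < 5"
  shows "inp (5 * int v - 2 + int j) =
    (int (parent I v) # encode_rat (val I v) @ encode_rat (wgt I v)) ! j"
proof -
  let ?f = "\<lambda>v. int (parent I v) # encode_rat (val I v) @ encode_rat (wgt I v)"
  have v: "1 \<le> v" "v \<le> n" using assms by (auto simp: nodes_eq)
  define k where "k = v - 1"
  have k: "v = Suc k" "k < n" using v by (auto simp: k_def)
  \<comment> \<open>Three header cells precede the records of length 5, and node \<open>v\<close> is
    record v - 1.\<close>
  have nat: "nat (5 * int v - 2 + int j) = 3 + (5 * k + j)" using k by simp
  have "3 + (5 * k + j) < length (encode I)" using k assms by (simp add: encode_length)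
  then have "inp (5 * int v - 2 + int j) = encode I ! (3 + (5 * k + j))"
    unfolding inp_def init_memory_def nat[symmetric] using k by simp
  also have "\<dots> = concat (map ?f [1..<n + 1]) ! (5 * k + j)"
    by (simp add: encode_def encode_rat_def n_def numeral_3_eq_3)
  also have "\<dots> = ?f ([1..<n + 1] ! k) ! j"
    using k assms by (intro nth_concat_blocks) (auto simp: encode_rat_def)
  also have "[1..<n + 1] ! k = v" using k by (simp del: upt_Suc)
  finally show ?thesis .
qed

lemma inp_fields:
  assumes "v \<in> nodes I"
  shows "inp (5 * int v - 2) = int (parent I v)"
    "inp (5 * int v - 1) = fst (quotient_of (val I v))"
    "inp (5 * int v) = snd (quotient_of (val I v))"
    "inp (5 * int v + 1) = fst (quotient_of (wgt I v))"
    "inp (5 * int v + 2) = snd (quotient_of (wgt I v))"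
  using inp_block[OF assms, of 0] inp_block[OF assms, of 1] inp_block[OF assms, of 2]
    inp_block[OF assms, of 3] inp_block[OF assms, of 4]
  by (simp_all add: encode_rat_def algebra_simps)

section \<open>Climbing in the tree and loops over the active nodes\<close>

lemma n_le_T: "n \<le> T"
  using T by (simp add: n_def)

text \<open>While \<open>u\<close> is neither 0 nor v, replacing it by its parent does not change
  whether v is an ancestor of it. At the end this is decided: true at v, false at the root.\<close>

lemma wp_walk:
  assumes "s ''in'' = inp" "s ''w'' 0 = int w" "s ''v'' 0 = int v" "w \<in> nodes I" "v \<in> nodes I"
    and Q: "\<And>s'. s' ''u'' 0 = (if anc v w then int v else 0) \<Longrightarrow>
      (\<And>X. X \<noteq> ''u'' \<Longrightarrow> s' X = s X) \<Longrightarrow> Q s'"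
  shows "wp T walk Q s"
proof -
  let ?J = "\<lambda>s'. \<exists>u. s' ''u'' 0 = int u \<and> u \<le> n \<and> (anc v w \<longleftrightarrow> anc v u) \<and> s' ''in'' = inp \<and>
      s' ''v'' 0 = int v"
  let ?m = "\<lambda>s'. depth (nat (s' ''u'' 0))"
  let ?b = "And (Less (Const 0) (reg ''u'')) (Not (eqb (reg ''u'') (reg ''v'')))"
  have dpos: "0 < depth u" if "u \<in> nodes I" for u using depth_parent[OF that] by simp
  have "wp T (While ?b (set_reg ''u'' (field ''u'' (-2))))
     (\<lambda>s'. s' ''u'' 0 = (if anc v w then int v else 0)) (s(''u'' := (s ''u'')(0 := int w)))"
  proof (rule wp_while_measure[where I = ?J and m = ?m])
    show "?J (s(''u'' := (s ''u'')(0 := int w)))"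
      using assms by (auto simp: nodes_eq)
    show "?m (s(''u'' := (s ''u'')(0 := int w))) \<le> T"
      using depth_le n_le_T order_trans by blast
  next
    fix s' assume "?J s'" and b: "bval ?b s'"
    then obtain u where u: "s' ''u'' 0 = int u" "u \<le> n" "anc v w \<longleftrightarrow> anc v u" "s' ''in'' = inp"
      "s' ''v'' 0 = int v" by blast
    then have un: "u \<in> nodes I" "u \<noteq> v" using b by (auto simp: nodes_eq)
    have "inp (5 * int u + - 2) = int (parent I u)" using inp_fields(1)[OF un(1)] by simp
    then show "wp T (set_reg ''u'' (field ''u'' (-2))) (\<lambda>s''. ?J s'' \<and> ?m s'' < ?m s') s'"
      using u un parent_le[OF un(1)] anc_parent_iff[OF un(1), of v] depth_parent[OF un(1)]
      by (simp add: field_def)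
    show "0 < ?m s'" using dpos[OF un(1)] u by simp
  next
    fix s' assume "?J s'" and b: "\<not> bval ?b s'"
    then obtain u where u: "s' ''u'' 0 = int u" "anc v w \<longleftrightarrow> anc v u"
      "s' ''v'' 0 = int v" by blast
    then have "u = 0 \<or> u = v" using b by auto
    moreover have "v \<noteq> 0" using assms(5) by (auto simp: nodes_eq)
    ultimately show "s' ''u'' 0 = (if anc v w then int v else 0)"
      using u anc_zero[of v] anc_refl by auto
  qed
  then have "wp T walk (\<lambda>s'. s' ''u'' 0 = (if anc v w then int v else 0)) s"
    using assms(2) by (simp add: walk_def)
  then show ?thesis by (rule wp_consequence) (use Q in auto)
qed

text \<open>The premise \<open>stable\<close> demands that the invariant ignore \<open>w\<close> and
  \<open>u\<close>, because the loop counter and the climb overwrite them between passes.\<close>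

lemma wp_for_active:
  assumes s: "s ''in'' = inp" "s ''v'' 0 = int v" "v \<in> nodes I"
    and c: "''in'' \<notin> writes c" "''w'' \<notin> writes c" "''v'' \<notin> writes c"
    and stable: "\<And>j s s'. Inv j s \<Longrightarrow> (\<And>X. X \<noteq> ''w'' \<Longrightarrow> X \<noteq> ''u'' \<Longrightarrow> s' X = s X) \<Longrightarrow> Inv j s'"
    and init: "Inv 1 s"
    and step: "\<And>j s'. j \<in> nodes I \<Longrightarrow> Inv j s' \<Longrightarrow> s' ''w'' 0 = int j \<Longrightarrow> s' ''v'' 0 = int v \<Longrightarrow>
       0 < s' ''act'' (int j) \<Longrightarrow> s' ''u'' 0 = (if anc v j then int v else 0) \<Longrightarrow>
       (\<And>X. X \<noteq> ''w'' \<Longrightarrow> X \<noteq> ''u'' \<Longrightarrow> X \<notin> writes c \<Longrightarrow> s' X = s X) \<Longrightarrow> wp T c (Inv (Suc j)) s'"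
    and skip: "\<And>j s'. j \<in> nodes I \<Longrightarrow> Inv j s' \<Longrightarrow> \<not> 0 < s' ''act'' (int j) \<Longrightarrow>
       (\<And>X. X \<noteq> ''w'' \<Longrightarrow> X \<noteq> ''u'' \<Longrightarrow> X \<notin> writes c \<Longrightarrow> s' X = s X) \<Longrightarrow> Inv (Suc j) s'"
  shows "wp T (for_active c) (Inv (Suc n)) s"
  unfolding for_active_def
proof (rule wp_for_nodes[where I = Inv])
  show "s ''in'' 0 = int n" using s(1) by (simp add: inp_head)
  show "Inv 1 (s(''w'' := (s ''w'')(0 := 1)))" using init by (rule stable) simp
next
  fix j s'
  assume j: "1 \<le> j" "j \<le> n" "s' ''w'' 0 = int j" "Inv j s'"
    and fr: "\<And>Y. Y \<noteq> ''w'' \<Longrightarrow>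
      Y \<notin> writes (If (Less (Const 0) (Cell ''act'' (reg ''w''))) (Seq walk c) Skip) \<Longrightarrow> s' Y = s Y"
  have jn: "j \<in> nodes I" using j by (simp add: nodes_eq)
  have fr': "s' X = s X" if "X \<noteq> ''w''" "X \<noteq> ''u''" "X \<notin> writes c" for X
    using fr[of X] that by simp
  have in': "s' ''in'' = inp" and v': "s' ''v'' 0 = int v"
    using fr'[of "''in''"] fr'[of "''v''"] s c by auto
  have stable': "Inv (Suc j) (s2(''w'' := (s2 ''w'')(0 := int (Suc j))))" if "Inv (Suc j) s2" for s2
    using that by (rule stable) simp
  show "wp T (If (Less (Const 0) (Cell ''act'' (reg ''w''))) (Seq walk c) Skip)
      (\<lambda>s''. Inv (Suc j) (s''(''w'' := (s'' ''w'')(0 := int (Suc j))))) s'"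
  proof (cases "0 < s' ''act'' (int j)")
    case True
    have "wp T walk (wp T c (\<lambda>s''. Inv (Suc j) (s''(''w'' := (s'' ''w'')(0 := int (Suc j)))))) s'"
    proof (rule wp_walk[OF in' j(3) v' jn s(3)])
      fix s2 assume u: "s2 ''u'' 0 = (if anc v j then int v else 0)"
        and fr2: "\<And>X. X \<noteq> ''u'' \<Longrightarrow> s2 X = s' X"
      have "wp T c (Inv (Suc j)) s2"
      proof (rule step[OF jn])
        show "Inv j s2" using j(4) by (rule stable) (use fr2 in auto)
      qed (use j v' True u fr2 fr' in auto)
      then show "wp T c (\<lambda>s''. Inv (Suc j) (s''(''w'' := (s'' ''w'')(0 := int (Suc j))))) s2"
        by (rule wp_mono) (rule stable')
    qed
    then show ?thesis using True j(3) by simp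
  next
    case False
    have "Inv (Suc j) s'" using skip[OF jn j(4) False] fr' by blast
    from stable'[OF this] show ?thesis using False j(3) by simp
  qed
qed (use n_le_T c in auto)

section \<open>Subtree sums and the choice of a densest subtree\<close>

definition active :: "memory \<Rightarrow> nat set \<Rightarrow> bool" where
  "active s A \<longleftrightarrow> A \<subseteq> nodes I \<and> (\<forall>w\<in>nodes I. s ''act'' (int w) = (if w \<in> A then 1 else 0))"

lemma wp_subtree_sums:
  assumes s: "s ''in'' = inp" "s ''v'' 0 = int v" "v \<in> nodes I" and act: "active s A"
    and ab: "\<And>w. s ''a'' (int w) = \<alpha> w" "\<And>w. s ''b'' (int w) = \<beta> w"
  shows "wp T subtree_sums
    (\<lambda>s'. s' ''sa'' 0 = sum \<alpha> (sub A v) \<and> s' ''sb'' 0 = sum \<beta> (sub A v)) s"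
proof -
  let ?Inv = "\<lambda>j s'. s' ''sa'' 0 = sum \<alpha> {w \<in> sub A v. w < j} \<and>
       s' ''sb'' 0 = sum \<beta> {w \<in> sub A v. w < j}"
  have AN: "A \<subseteq> nodes I" using act by (simp add: active_def)
  have fin: "finite {w \<in> sub A v. w < j}" for j
    using AN finite_nodes sub_subset[of A v] by (auto intro: finite_subset)
  have upd: "{w \<in> sub A v. w < Suc j} =
      (if j \<in> sub A v then insert j {w \<in> sub A v. w < j} else {w \<in> sub A v. w < j})" for j
    by (auto simp: less_Suc_eq)
  have "sub A v \<subseteq> {1..n}" using AN sub_subset[of A v] by (auto simp: nodes_eq)
  then have bounds: "{w \<in> sub A v. w < Suc n} = sub A v" "{w \<in> sub A v. w < 1} = {}" by auto
  let ?s = "s(''sa'' := (s ''sa'')(0 := 0), ''sb'' := (s ''sb'')(0 := 0))"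
  have "wp T (for_active (If (eqb (reg ''u'') (reg ''v''))
       (Seq (set_reg ''sa'' (Add (reg ''sa'') (Cell ''a'' (reg ''w''))))
            (set_reg ''sb'' (Add (reg ''sb'') (Cell ''b'' (reg ''w'')))))
       Skip)) (?Inv (Suc n)) ?s"
  proof (rule wp_for_active[where v = v and Inv = ?Inv])
    show "?Inv 1 ?s" unfolding bounds by simp
  next
    fix j s'
    assume j: "j \<in> nodes I" "?Inv j s'" "s' ''w'' 0 = int j" "s' ''v'' 0 = int v"
      "0 < s' ''act'' (int j)" "s' ''u'' 0 = (if anc v j then int v else 0)"
      and fr: "\<And>X. X \<noteq> ''w'' \<Longrightarrow> X \<noteq> ''u'' \<Longrightarrow> X \<notin> writes (If (eqb (reg ''u'') (reg ''v''))
       (Seq (set_reg ''sa'' (Add (reg ''sa'') (Cell ''a'' (reg ''w''))))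
            (set_reg ''sb'' (Add (reg ''sb'') (Cell ''b'' (reg ''w'')))))
       Skip) \<Longrightarrow> s' X = ?s X"
    have banks: "s' ''act'' = s ''act''" "s' ''a'' = s ''a''" "s' ''b'' = s ''b''"
      using fr[of "''act''"] fr[of "''a''"] fr[of "''b''"] by auto
    have "j \<in> A" using j(1,5) act by (auto simp: banks active_def split: if_splits)
    then have "j \<in> sub A v \<longleftrightarrow> anc v j" by (simp add: sub_def)
    \<comment> \<open>Separates the two outcomes of \<open>walk\<close>: the 0 left after reaching
      the root must not be mistaken for v.\<close>
    moreover have "v \<noteq> 0" using s(3) by (auto simp: nodes_eq)
    ultimately show "wp T (If (eqb (reg ''u'') (reg ''v''))
       (Seq (set_reg ''sa'' (Add (reg ''sa'') (Cell ''a'' (reg ''w''))))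
            (set_reg ''sb'' (Add (reg ''sb'') (Cell ''b'' (reg ''w'')))))
       Skip) (?Inv (Suc j)) s'"
      using j fin ab by (auto simp: banks upd)
  next
    fix j s'
    assume j: "j \<in> nodes I" "?Inv j s'" "\<not> 0 < s' ''act'' (int j)"
      and fr: "\<And>X. X \<noteq> ''w'' \<Longrightarrow> X \<noteq> ''u'' \<Longrightarrow> X \<notin> writes (If (eqb (reg ''u'') (reg ''v''))
       (Seq (set_reg ''sa'' (Add (reg ''sa'') (Cell ''a'' (reg ''w''))))
            (set_reg ''sb'' (Add (reg ''sb'') (Cell ''b'' (reg ''w'')))))
       Skip) \<Longrightarrow> s' X = ?s X"
    have banks: "s' ''act'' = s ''act''" using fr[of "''act''"] by auto
    have "j \<notin> sub A v" using j(1,3) act by (auto simp: banks active_def sub_def)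
    then show "?Inv (Suc j) s'" using j by (simp add: upd)
  qed (use s in auto)
  then show ?thesis by (simp add: subtree_sums_def bounds)
qed

text \<open>Transitivity of a''/b'' \<le> a'/b' < a/b without division: both sides are compared
  after multiplication by b' > 0, and b'' = 0 is allowed.\<close>

lemma densest_step:
  fixes a a' a'' b b' b'' :: int
  assumes "a'' * b' \<le> a' * b''" "b * a' < a * b'" "0 < b'" "0 < b" "0 \<le> b''"
  shows "a'' * b \<le> a * b''"
proof -
  have "b' * (a'' * b) = (a'' * b') * b" by simp
  also have "\<dots> \<le> (a' * b'') * b" using assms by (intro mult_right_mono) auto
  also have "\<dots> = (b * a') * b''" by simp
  also have "\<dots> \<le> (a * b') * b''" using assms by (intro mult_right_mono) auto
  also have "\<dots> = b' * (a * b'')" by simp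
  finally show ?thesis using assms(3) by simp
qed

lemma wp_scan:
  assumes s: "s ''in'' = inp" and act: "active s A"
    and ab: "\<And>w. s ''a'' (int w) = \<alpha> w" "\<And>w. s ''b'' (int w) = \<beta> w"
    and nn: "\<And>w. w \<in> nodes I \<Longrightarrow> 0 \<le> \<alpha> w" "\<And>w. w \<in> nodes I \<Longrightarrow> 0 \<le> \<beta> w"
  shows "wp T scan (\<lambda>s'. A = {} \<and> s' ''best'' 0 = 0 \<or>
    (\<exists>v. densest \<alpha> \<beta> A v \<and> s' ''best'' 0 = int v \<and> s' ''bestb'' 0 = sum \<beta> (sub A v))) s"
proof -
  define a where "a v = sum \<alpha> (sub A v)" for v
  define b where "b v = sum \<beta> (sub A v)" for v
  have AN: "A \<subseteq> nodes I" using act by (simp add: active_def)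
  have a0: "0 \<le> a v" and b0: "0 \<le> b v" for v
    unfolding a_def b_def using nn AN sub_subset[of A v] by (auto intro!: sum_nonneg)
  \<comment> \<open>Either no active node has been met yet and the initial pair is in place, or the
    stored node is weightless or at least as dense as every active node seen so far.\<close>
  let ?Inv = "\<lambda>j s'. (\<forall>u\<in>A. j \<le> u) \<and> s' ''best'' 0 = 0 \<and> s' ''besta'' 0 = - 1 \<and> s' ''bestb'' 0 = 1 \<or>
     (\<exists>v\<in>A. s' ''best'' 0 = int v \<and> s' ''besta'' 0 = a v \<and> s' ''bestb'' 0 = b v \<and>
        (b v = 0 \<or> 0 < b v \<and> (\<forall>u\<in>A. u < j \<longrightarrow> a u * b v \<le> a v * b u)))"
  let ?s = "s(''best'' := (s ''best'')(0 := 0), ''besta'' := (s ''besta'')(0 := - 1),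
     ''bestb'' := (s ''bestb'')(0 := 1))"
  let ?upd = "If (And (Less (Const 0) (reg ''sb''))
               (Not (Less (Mul (reg ''sb'') (reg ''besta'')) (Mul (reg ''sa'') (reg ''bestb'')))))
           Skip
           (Seq (set_reg ''best'' (reg ''v''))
             (Seq (set_reg ''besta'' (reg ''sa'')) (set_reg ''bestb'' (reg ''sb''))))"
  let ?body = "If (Less (Const 0) (Cell ''act'' (reg ''v''))) (Seq subtree_sums ?upd) Skip"
  have "wp T (for_nodes ''v'' ?body) (\<lambda>s'. A = {} \<and> s' ''best'' 0 = 0 \<or>
    (\<exists>v. densest \<alpha> \<beta> A v \<and> s' ''best'' 0 = int v \<and> s' ''bestb'' 0 = sum \<beta> (sub A v))) ?s"
  proof (rule wp_for_nodes[where I = ?Inv])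
    show "?s ''in'' 0 = int n" using s by (simp add: inp_head)
    show "?Inv 1 (?s(''v'' := (?s ''v'')(0 := 1)))" using AN by (auto simp: nodes_eq)
  next
    fix j s'
    assume j: "1 \<le> j" "j \<le> n" "s' ''v'' 0 = int j" and inv: "?Inv j s'"
      and fr: "\<And>Y. Y \<noteq> ''v'' \<Longrightarrow> Y \<notin> writes ?body \<Longrightarrow> s' Y = ?s Y"
    have banks: "s' ''act'' = s ''act''" "s' ''a'' = s ''a''" "s' ''b'' = s ''b''" "s' ''in'' = inp"
      using fr[of "''act''"] fr[of "''a''"] fr[of "''b''"] fr[of "''in''"] s by auto
    have jn: "j \<in> nodes I" using j by (simp add: nodes_eq)
    show "wp T ?body (\<lambda>s''. ?Inv (Suc j) (s''(''v'' := (s'' ''v'')(0 := int (Suc j))))) s'"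
    proof (cases "j \<in> A")
      case False
      then have "s' ''act'' (int j) = 0" using act jn by (simp add: banks active_def)
      moreover have "?Inv (Suc j) s'"
        using inv False by (auto simp: less_Suc_eq Suc_le_eq le_less)
      ultimately show ?thesis using j(3) by simp
    next
      case True
      then have actj: "s' ''act'' (int j) = 1" using act jn by (simp add: banks active_def)
      have "active s' A" using act by (simp add: active_def banks)
      from wp_subtree_sums[OF banks(4) j(3) jn this, of \<alpha> \<beta>]
      have "wp T subtree_sums (\<lambda>s'. s' ''sa'' 0 = a j \<and> s' ''sb'' 0 = b j) s'"
        using ab by (simp add: banks a_def b_def)
      then have "wp T subtree_sums
        (wp T ?upd (\<lambda>s''. ?Inv (Suc j) (s''(''v'' := (s'' ''v'')(0 := int (Suc j)))))) s'"
      proof (rule wp_consequence)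
        fix s2 assume sab: "s2 ''sa'' 0 = a j \<and> s2 ''sb'' 0 = b j"
          and fr2: "\<And>X. X \<notin> writes subtree_sums \<Longrightarrow> s2 X = s' X"
        have regs: "s2 ''v'' = s' ''v''" "s2 ''best'' = s' ''best''" "s2 ''besta'' = s' ''besta''"
          "s2 ''bestb'' = s' ''bestb''" by (auto intro: fr2)
        have case_new: "?Inv (Suc j) s3"
          if "s3 ''best'' 0 = int j" "s3 ''besta'' 0 = a j" "s3 ''bestb'' 0 = b j"
            "b j = 0 \<or> b j * s' ''besta'' 0 < a j * s' ''bestb'' 0" for s3
        proof -
          have "b j = 0 \<or> 0 < b j \<and> (\<forall>u\<in>A. u < Suc j \<longrightarrow> a u * b j \<le> a j * b u)"
          proof (cases "b j = 0")
            case False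
            then have bj: "0 < b j" using b0[of j] by simp
            have lt: "b j * s' ''besta'' 0 < a j * s' ''bestb'' 0" using that False by blast
            have "a u * b j \<le> a j * b u" if u: "u \<in> A" "u < j" for u
            proof -
              \<comment> \<open>An active node \<open>u\<close> before \<open>j\<close> excludes the
                initial disjunct. The previous best cannot be weightless either, as the strict
                comparison would then put a nonnegative product below 0.\<close>
              from inv u obtain v where v: "v \<in> A" "s' ''besta'' 0 = a v" "s' ''bestb'' 0 = b v"
                "b v = 0 \<or> 0 < b v \<and> a u * b v \<le> a v * b u" by fastforce
              moreover have "b v \<noteq> 0" using lt v mult_nonneg_nonneg[OF b0[of j] a0[of v]] by auto
              ultimately show ?thesis
                using densest_step[of "a u" "b v" "a v" "b u" "b j" "a j"] lt bj b0 by auto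
            qed
            then show ?thesis using bj by (auto simp: less_Suc_eq)
          qed simp
          then show ?thesis using True that(1-3) by blast
        qed
        have case_old: "?Inv (Suc j) s3"
          if "0 < b j" "\<not> b j * s' ''besta'' 0 < a j * s' ''bestb'' 0"
            "s3 ''best'' = s' ''best''" "s3 ''besta'' = s' ''besta''" "s3 ''bestb'' = s' ''bestb''" for s3
        proof -
          \<comment> \<open>Against the pair (-1, 1) the comparison reads
            \<open>- b j < a j\<close>, which holds, so the first active node is always
            stored.\<close>
          have "\<not> (s' ''besta'' 0 = - 1 \<and> s' ''bestb'' 0 = 1)" using that(1,2) a0[of j] by auto
          with inv obtain v where v: "v \<in> A" "s' ''best'' 0 = int v" "s' ''besta'' 0 = a v"
            "s' ''bestb'' 0 = b v" "b v = 0 \<or> 0 < b v \<and> (\<forall>u\<in>A. u < j \<longrightarrow> a u * b v \<le> a v * b u)"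
            by blast
          moreover have "a j * b v \<le> a v * b j" using that(2) v by (simp add: mult.commute)
          ultimately show ?thesis using that(3-5) by (auto simp: less_Suc_eq)
        qed
        show "wp T ?upd (\<lambda>s''. ?Inv (Suc j) (s''(''v'' := (s'' ''v'')(0 := int (Suc j))))) s2"
        proof (cases "0 < b j \<and> \<not> b j * s' ''besta'' 0 < a j * s' ''bestb'' 0")
          case True
          have "?Inv (Suc j) (s2(''v'' := (s2 ''v'')(0 := int (Suc j))))"
            by (rule case_old) (use True in \<open>auto simp: regs\<close>)
          then show ?thesis using True sab by (simp add: regs)
        next
          case False
          then have new: "b j = 0 \<or> b j * s' ''besta'' 0 < a j * s' ''bestb'' 0"
            using b0[of j] by auto
          let ?s3 = "s2(''best'' := (s2 ''best'')(0 := int j), ''besta'' := (s2 ''besta'')(0 := a j),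
             ''bestb'' := (s2 ''bestb'')(0 := b j), ''v'' := (s2 ''v'')(0 := int (Suc j)))"
          have "?Inv (Suc j) ?s3"
            by (rule case_new) (use new in auto)
          moreover have notb: "\<not> bval (And (Less (Const 0) (reg ''sb''))
               (Not (Less (Mul (reg ''sb'') (reg ''besta'')) (Mul (reg ''sa'') (reg ''bestb''))))) s2"
            using False sab by (simp add: regs)
          ultimately show ?thesis
            unfolding wp.simps(4) if_not_P[OF notb] using sab j(3) by (simp add: regs)
        qed
      qed
      then show ?thesis using actj j(3) by simp
    qed
  next
    fix s' assume inv: "?Inv (Suc n) s'"
    have lt: "u < Suc n" if "u \<in> A" for u using that AN by (auto simp: nodes_eq)
    show "A = {} \<and> s' ''best'' 0 = 0 \<or>
      (\<exists>v. densest \<alpha> \<beta> A v \<and> s' ''best'' 0 = int v \<and> s' ''bestb'' 0 = sum \<beta> (sub A v))"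
      using inv
    proof
      assume "(\<forall>u\<in>A. Suc n \<le> u) \<and> s' ''best'' 0 = 0 \<and> s' ''besta'' 0 = - 1 \<and> s' ''bestb'' 0 = 1"
      then show ?thesis using lt by force
    next
      assume "\<exists>v\<in>A. s' ''best'' 0 = int v \<and> s' ''besta'' 0 = a v \<and> s' ''bestb'' 0 = b v \<and>
        (b v = 0 \<or> 0 < b v \<and> (\<forall>u\<in>A. u < Suc n \<longrightarrow> a u * b v \<le> a v * b u))"
      then show ?thesis using lt unfolding densest_def a_def b_def by blast
    qed
  qed (use n_le_T in auto)
  then show ?thesis by (simp add: scan_def)
qed

section \<open>Updates of the active set and the greedy loop\<close>

lemma wp_take_subtree:
  assumes s: "s ''in'' = inp" "s ''v'' 0 = int v" "v \<in> nodes I" and act: "active s A"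
  shows "wp T take_subtree (\<lambda>s'. s' ''r'' 0 = s ''r'' 0 - s ''bestb'' 0 \<and> active s' (A - sub A v) \<and>
     (\<forall>w\<in>nodes I. s' ''out'' (int w) = (if w \<in> sub A v then 1 else s ''out'' (int w)))) s"
proof -
  let ?s = "s(''r'' := (s ''r'')(0 := s ''r'' 0 - s ''bestb'' 0))"
  let ?Inv = "\<lambda>j s'. s' ''r'' 0 = s ''r'' 0 - s ''bestb'' 0 \<and> (\<forall>w\<in>nodes I.
      s' ''act'' (int w) = (if w \<in> A \<and> \<not> (w \<in> sub A v \<and> w < j) then 1 else 0) \<and>
      s' ''out'' (int w) = (if w \<in> sub A v \<and> w < j then 1 else s ''out'' (int w)))"
  let ?c = "If (eqb (reg ''u'') (reg ''v''))
       (Seq (Store ''out'' (reg ''w'') (Const 1)) (Store ''act'' (reg ''w'') (Const 0))) Skip"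
  have AN: "A \<subseteq> nodes I" using act by (simp add: active_def)
  have v0: "v \<noteq> 0" using s(3) by (auto simp: nodes_eq)
  have "wp T (for_active ?c) (?Inv (Suc n)) ?s"
  proof (rule wp_for_active[where v = v and Inv = ?Inv])
    show "?Inv 1 ?s" using act by (auto simp: active_def nodes_eq)
  next
    fix j s'
    assume j: "j \<in> nodes I" "?Inv j s'" "s' ''w'' 0 = int j" "s' ''v'' 0 = int v"
      "0 < s' ''act'' (int j)" "s' ''u'' 0 = (if anc v j then int v else 0)"
    have "j \<in> A" using j(1,2,5) by (auto split: if_splits)
    then show "wp T ?c (?Inv (Suc j)) s'"
      using j v0 by (auto simp: sub_def less_Suc_eq)
  next
    fix j s'
    assume "j \<in> nodes I" "?Inv j s'" "\<not> 0 < s' ''act'' (int j)"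
    then show "?Inv (Suc j) s'" by (auto simp: less_Suc_eq sub_def)
  qed (use s in auto)
  then have "wp T (for_active ?c) (\<lambda>s'. s' ''r'' 0 = s ''r'' 0 - s ''bestb'' 0 \<and>
     active s' (A - sub A v) \<and>
     (\<forall>w\<in>nodes I. s' ''out'' (int w) = (if w \<in> sub A v then 1 else s ''out'' (int w)))) ?s"
    by (rule wp_mono) (use AN in \<open>auto simp: active_def nodes_eq\<close>)
  then show ?thesis by (simp add: take_subtree_def)
qed

lemma wp_drop_node:
  assumes s: "s ''in'' = inp" "s ''v'' 0 = int v" "v \<in> nodes I" and act: "active s A"
  shows "wp T drop_node (\<lambda>s'. active s' (sub A v - {v})) s"
proof -
  let ?Inv = "\<lambda>j s'. s' ''v'' 0 = int v \<and> (\<forall>w\<in>nodes I.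
      s' ''act'' (int w) = (if w \<in> A \<and> (w < j \<longrightarrow> w \<in> sub A v) then 1 else 0))"
  let ?c = "If (eqb (reg ''u'') (reg ''v'')) Skip (Store ''act'' (reg ''w'') (Const 0))"
  have AN: "A \<subseteq> nodes I" using act by (simp add: active_def)
  have v0: "v \<noteq> 0" using s(3) by (auto simp: nodes_eq)
  have "wp T (for_active ?c) (?Inv (Suc n)) s"
  proof (rule wp_for_active[where v = v and Inv = ?Inv])
    show "?Inv 1 s" using s act by (auto simp: active_def nodes_eq)
  next
    fix j s'
    assume j: "j \<in> nodes I" "?Inv j s'" "s' ''w'' 0 = int j" "s' ''v'' 0 = int v"
      "0 < s' ''act'' (int j)" "s' ''u'' 0 = (if anc v j then int v else 0)"
    have "j \<in> A" using j(1,2,5) by (auto split: if_splits)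
    then show "wp T ?c (?Inv (Suc j)) s'"
      using j v0 by (auto simp: sub_def less_Suc_eq)
  next
    fix j s'
    assume "j \<in> nodes I" "?Inv j s'" "\<not> 0 < s' ''act'' (int j)"
    then show "?Inv (Suc j) s'" by (auto simp: less_Suc_eq sub_def)
  qed (use s in auto)
  then have "wp T (for_active ?c)
      (\<lambda>s'. active (s'(''act'' := (s' ''act'')(s' ''v'' 0 := 0))) (sub A v - {v})) s"
    by (rule wp_mono) (use AN in \<open>auto simp: active_def nodes_eq sub_def\<close>)
  then show ?thesis by (simp add: drop_node_def)
qed

lemma densest_of_int:
  "densest \<alpha> \<beta> A v \<Longrightarrow> densest (\<lambda>w. real_of_int (\<alpha> w)) (\<lambda>w. real_of_int (\<beta> w)) A v"
  unfolding densest_def of_int_sum[symmetric] of_int_mult[symmetric] of_int_le_iff of_int_0_less_iff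
    of_int_eq_0_iff .

text \<open>The alternative \<open>A' = {}\<close> covers the idle round. In the other rounds the
  active set shrinks strictly because the selected node leaves it.\<close>

lemma wp_greedy_step:
  assumes s: "s ''in'' = inp" and act: "active s A"
    and ab: "\<And>w. s ''a'' (int w) = \<alpha> w" "\<And>w. s ''b'' (int w) = \<beta> w"
    and nn: "\<And>w. w \<in> nodes I \<Longrightarrow> 0 \<le> \<alpha> w" "\<And>w. w \<in> nodes I \<Longrightarrow> 0 \<le> \<beta> w"
    and out: "\<And>w. w \<in> nodes I \<Longrightarrow> s ''out'' (int w) = (if w \<in> S then 1 else 0 :: int)"
    and inv: "greedy_inv (\<lambda>w. real_of_int (\<alpha> w)) (\<lambda>w. real_of_int (\<beta> w)) (nodes I) B A S (s ''r'' 0)"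
  shows "wp T greedy_step (\<lambda>s'. \<exists>A' S'. (A' = {} \<or> A' \<subset> A) \<and> active s' A' \<and>
    (\<forall>w\<in>nodes I. s' ''out'' (int w) = (if w \<in> S' then 1 else 0 :: int)) \<and>
    greedy_inv (\<lambda>w. real_of_int (\<alpha> w)) (\<lambda>w. real_of_int (\<beta> w)) (nodes I) B A' S' (s' ''r'' 0)) s"
    (is "wp T greedy_step ?Q s")
proof -
  let ?choose = "If (Less (Const 0) (reg ''best''))
     (Seq (set_reg ''v'' (reg ''best''))
       (If (Less (reg ''r'') (reg ''bestb'')) drop_node take_subtree))
     Skip"
  have AN: "A \<subseteq> nodes I" using act by (simp add: active_def)
  have "wp T scan (wp T ?choose ?Q) s"
  proof (rule wp_consequence[OF wp_scan[OF s act ab nn]])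
    fix s1
    assume best: "A = {} \<and> s1 ''best'' 0 = 0 \<or>
       (\<exists>v. densest \<alpha> \<beta> A v \<and> s1 ''best'' 0 = int v \<and> s1 ''bestb'' 0 = sum \<beta> (sub A v))"
      and fr: "\<And>X. X \<notin> writes scan \<Longrightarrow> s1 X = s X"
    have banks: "s1 ''in'' = inp" "s1 ''act'' = s ''act''" "s1 ''out'' = s ''out''" "s1 ''r'' = s ''r''"
      using s by (auto simp: fr)
    from best show "wp T ?choose ?Q s1"
    proof
      assume "A = {} \<and> s1 ''best'' 0 = 0"
      moreover from this have "?Q s1"
        using act out inv by (intro exI[of _ A] exI[of _ S]) (auto simp: banks active_def)
      ultimately show ?thesis by simp
    next
      assume "\<exists>v. densest \<alpha> \<beta> A v \<and> s1 ''best'' 0 = int v \<and> s1 ''bestb'' 0 = sum \<beta> (sub A v)"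
      then obtain v where dens: "densest \<alpha> \<beta> A v" and v: "s1 ''best'' 0 = int v"
        and w: "s1 ''bestb'' 0 = sum \<beta> (sub A v)" by blast
      have vA: "v \<in> A" "v \<in> sub A v" using dens by (auto simp: densest_def sub_def anc_refl)
      then have vN: "v \<in> nodes I" using AN by blast
      then have v0: "v \<noteq> 0" by (auto simp: nodes_eq)
      let ?s = "s1(''v'' := (s1 ''v'')(0 := int v))"
      have s2: "?s ''in'' = inp" "?s ''v'' 0 = int v" "active ?s A"
        using act by (simp_all add: banks active_def)
      note densR = densest_of_int[OF dens]
      show ?thesis
      proof (cases "s ''r'' 0 < sum \<beta> (sub A v)")
        case True
        have "wp T drop_node ?Q ?s"
        proof (rule wp_consequence[OF wp_drop_node[OF s2(1,2) vN s2(3)]])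
          fix s3 assume act3: "active s3 (sub A v - {v})"
            and fr3: "\<And>X. X \<notin> writes drop_node \<Longrightarrow> s3 X = ?s X"
          have "s3 ''out'' = s ''out''" "s3 ''r'' = s ''r''" by (auto simp: fr3 banks)
          moreover have "greedy_inv (\<lambda>w. real_of_int (\<alpha> w)) (\<lambda>w. real_of_int (\<beta> w)) (nodes I) B
             (sub A v - {v}) S (s ''r'' 0)"
            using True nn
            by (intro greedy_inv_drop[OF finite_nodes inv densR])
              (simp_all add: of_int_sum[symmetric] del: of_int_sum)
          moreover have "sub A v - {v} \<subset> A" using vA sub_subset[of A v] by blast
          ultimately show "?Q s3" using act3 out by (intro exI[of _ "sub A v - {v}"] exI[of _ S]) auto
        qed
        then show ?thesis using True v v0 w by (simp add: banks)
      next
        case False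
        have "wp T take_subtree ?Q ?s"
        proof (rule wp_mono[OF wp_take_subtree[OF s2(1,2) vN s2(3)]])
          fix s3 assume s3: "s3 ''r'' 0 = ?s ''r'' 0 - ?s ''bestb'' 0 \<and> active s3 (A - sub A v) \<and>
             (\<forall>w\<in>nodes I. s3 ''out'' (int w) = (if w \<in> sub A v then 1 else ?s ''out'' (int w)))"
          have r: "real_of_int (s3 ''r'' 0) =
             real_of_int (s ''r'' 0) - (\<Sum>w\<in>sub A v. real_of_int (\<beta> w))"
            using s3 w by (simp add: banks)
          have "greedy_inv (\<lambda>w. real_of_int (\<alpha> w)) (\<lambda>w. real_of_int (\<beta> w)) (nodes I) B
             (A - sub A v) (S \<union> sub A v) (s3 ''r'' 0)"
            unfolding r using False nn
            by (intro greedy_inv_take[OF finite_nodes inv densR])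
              (simp_all add: of_int_sum[symmetric] del: of_int_sum)
          moreover have "A - sub A v \<subset> A" using vA by blast
          ultimately show "?Q s3" using s3 out
            by (intro exI[of _ "A - sub A v"] exI[of _ "S \<union> sub A v"]) (auto simp: banks)
        qed
        then show ?thesis using False v v0 w by (simp add: banks)
      qed
    qed
  qed
  then show ?thesis by (simp only: greedy_step_def wp.simps)
qed

lemma wp_greedy_loop:
  assumes s: "s ''in'' = inp" and act: "active s (nodes I)"
    and ab: "\<And>w. s ''a'' (int w) = \<alpha> w" "\<And>w. s ''b'' (int w) = \<beta> w"
    and nn: "\<And>w. w \<in> nodes I \<Longrightarrow> 0 \<le> \<alpha> w" "\<And>w. w \<in> nodes I \<Longrightarrow> 0 \<le> \<beta> w"
    and out: "\<And>w. w \<in> nodes I \<Longrightarrow> s ''out'' (int w) = 0"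
    and r: "0 \<le> s ''r'' 0"
  shows "wp T (for_nodes ''k'' greedy_step) (\<lambda>s'. \<exists>S.
    (\<forall>w\<in>nodes I. s' ''out'' (int w) = (if w \<in> S then 1 else 0 :: int)) \<and>
    greedy_inv (\<lambda>w. real_of_int (\<alpha> w)) (\<lambda>w. real_of_int (\<beta> w)) (nodes I) (s ''r'' 0) {} S (s' ''r'' 0)) s"
proof -
  let ?inv = "greedy_inv (\<lambda>w. real_of_int (\<alpha> w)) (\<lambda>w. real_of_int (\<beta> w)) (nodes I) (s ''r'' 0)"
  \<comment> \<open>Before round j at most n + 1 - j nodes are active, so none is left after n
    rounds.\<close>
  let ?Inv = "\<lambda>j s'. \<exists>A S. card A + j \<le> Suc n \<and> active s' A \<and>
    (\<forall>w\<in>nodes I. s' ''out'' (int w) = (if w \<in> S then 1 else 0 :: int)) \<and> ?inv A S (s' ''r'' 0)"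
  show ?thesis
  proof (rule wp_for_nodes[where I = ?Inv and n = n])
    show "s ''in'' 0 = int n" using s by (simp add: inp_head)
    show "?Inv 1 (s(''k'' := (s ''k'')(0 := 1)))"
      using act out r greedy_inv_init[of "real_of_int (s ''r'' 0)"]
      by (intro exI[of _ "nodes I"] exI[of _ "{}"]) (auto simp: active_def n_def)
  next
    fix j s' assume j: "1 \<le> j" "j \<le> n" "?Inv j s'"
      and fr: "\<And>Y. Y \<noteq> ''k'' \<Longrightarrow> Y \<notin> writes greedy_step \<Longrightarrow> s' Y = s Y"
    from j(3) obtain A S where A: "card A + j \<le> Suc n" "active s' A"
      "\<And>w. w \<in> nodes I \<Longrightarrow> s' ''out'' (int w) = (if w \<in> S then 1 else 0 :: int)" "?inv A S (s' ''r'' 0)"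
      by blast
    have banks: "s' ''in'' = inp" "s' ''a'' = s ''a''" "s' ''b'' = s ''b''"
      using s by (auto simp: fr)
    have "finite A" using A(2) finite_nodes by (auto simp: active_def intro: finite_subset)
    have card: "card A' + Suc j \<le> Suc n" if "A' = {} \<or> A' \<subset> A" for A'
      using that
    proof
      assume "A' = {}"
      then show ?thesis using j(2) by simp
    next
      assume "A' \<subset> A"
      from psubset_card_mono[OF \<open>finite A\<close> this] show ?thesis using A(1) by simp
    qed
    show "wp T greedy_step (\<lambda>s''. ?Inv (Suc j) (s''(''k'' := (s'' ''k'')(0 := int (Suc j))))) s'"
    proof (rule wp_mono[OF wp_greedy_step[OF banks(1) A(2) _ _ nn A(3,4)]])
      show "s' ''a'' (int w) = \<alpha> w" "s' ''b'' (int w) = \<beta> w" for w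
        using ab by (auto simp: banks)
    next
      fix s2 assume "\<exists>A' S'. (A' = {} \<or> A' \<subset> A) \<and> active s2 A' \<and>
        (\<forall>w\<in>nodes I. s2 ''out'' (int w) = (if w \<in> S' then 1 else 0 :: int)) \<and> ?inv A' S' (s2 ''r'' 0)"
      then obtain A' S' where "card A' + Suc j \<le> Suc n" "active s2 A'"
        "\<forall>w\<in>nodes I. s2 ''out'' (int w) = (if w \<in> S' then 1 else 0 :: int)" "?inv A' S' (s2 ''r'' 0)"
        using card by blast
      then show "?Inv (Suc j) (s2(''k'' := (s2 ''k'')(0 := int (Suc j))))"
        by (intro exI[of _ A'] exI[of _ S']) (auto simp: active_def)
    qed
  next
    fix s' assume "?Inv (Suc n) s'"
    then obtain A S where A: "card A + Suc n \<le> Suc n" "active s' A"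
      "\<forall>w\<in>nodes I. s' ''out'' (int w) = (if w \<in> S then 1 else 0 :: int)" "?inv A S (s' ''r'' 0)" by blast
    have "finite A" using A(2) finite_nodes by (auto simp: active_def intro: finite_subset)
    then have "A = {}" using A(1) by simp
    then show "\<exists>S. (\<forall>w\<in>nodes I. s' ''out'' (int w) = (if w \<in> S then 1 else 0 :: int)) \<and>
       ?inv {} S (s' ''r'' 0)" using A by blast
  qed (use n_le_T in auto)
qed

section \<open>Scaling the rational data to integers\<close>

lemma wp_denominators:
  assumes s: "s ''in'' = inp"
  shows "wp T denominators (\<lambda>s'. 0 < s' ''d'' 0 \<and> inp 2 dvd s' ''d'' 0 \<and>
    (\<forall>v\<in>nodes I. inp (5 * int v) dvd s' ''d'' 0 \<and> inp (5 * int v + 2) dvd s' ''d'' 0)) s"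
proof -
  let ?Inv = "\<lambda>j s'. 0 < s' ''d'' 0 \<and> inp 2 dvd s' ''d'' 0 \<and>
    (\<forall>v\<in>nodes I. v < j \<longrightarrow> inp (5 * int v) dvd s' ''d'' 0 \<and> inp (5 * int v + 2) dvd s' ''d'' 0)"
  let ?s = "s(''d'' := (s ''d'')(0 := inp 2))"
  have "wp T (for_nodes ''i'' (set_reg ''d'' (Mul (Mul (reg ''d'') (field ''i'' 0)) (field ''i'' 2))))
    (\<lambda>s'. 0 < s' ''d'' 0 \<and> inp 2 dvd s' ''d'' 0 \<and>
    (\<forall>v\<in>nodes I. inp (5 * int v) dvd s' ''d'' 0 \<and> inp (5 * int v + 2) dvd s' ''d'' 0)) ?s"
  proof (rule wp_for_nodes[where I = ?Inv and n = n])
    show "?s ''in'' 0 = int n" using s by (simp add: inp_head)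
    show "?Inv 1 (?s(''i'' := (?s ''i'')(0 := 1)))"
      by (auto simp: inp_head quotient_of_denom_pos' nodes_eq)
  next
    fix j s' assume j: "1 \<le> j" "j \<le> n" "s' ''i'' 0 = int j" "?Inv j s'"
      and fr: "\<And>Y. Y \<noteq> ''i'' \<Longrightarrow> Y \<notin> writes (set_reg ''d'' (Mul (Mul (reg ''d'') (field ''i'' 0)) (field ''i'' 2)))
         \<Longrightarrow> s' Y = ?s Y"
    have jn: "j \<in> nodes I" using j by (simp add: nodes_eq)
    have "s' ''in'' = inp" using s by (simp add: fr)
    moreover have "0 < inp (5 * int j)" "0 < inp (5 * int j + 2)"
      using inp_fields[OF jn] by (simp_all add: quotient_of_denom_pos')
    ultimately show "wp T (set_reg ''d'' (Mul (Mul (reg ''d'') (field ''i'' 0)) (field ''i'' 2)))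
      (\<lambda>s''. ?Inv (Suc j) (s''(''i'' := (s'' ''i'')(0 := int (Suc j))))) s'"
      using j by (auto simp: field_def less_Suc_eq)
  qed (use n_le_T in \<open>auto simp: nodes_eq\<close>)
  then show ?thesis using s by (simp add: denominators_def)
qed

lemma scaled_quotient:
  assumes "snd (quotient_of q) dvd d"
  shows "real_of_int (fst (quotient_of q) * (d div snd (quotient_of q))) = real_of_int d * real_of_rat q"
proof -
  obtain e where e: "d = snd (quotient_of q) * e" using assms by blast
  have pos: "0 < snd (quotient_of q)" by (rule quotient_of_denom_pos')
  have "real_of_rat q = real_of_int (fst (quotient_of q)) / real_of_int (snd (quotient_of q))"
    by (subst quotient_of_split) (simp add: of_rat_divide)
  then show ?thesis using pos by (simp add: e)
qed

lemma wp_scale: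
  assumes s: "s ''in'' = inp" and d: "s ''d'' 0 = d" "inp 2 dvd d"
    "\<And>v. v \<in> nodes I \<Longrightarrow> inp (5 * int v) dvd d \<and> inp (5 * int v + 2) dvd d"
  shows "wp T scale (\<lambda>s'. active s' (nodes I) \<and>
    real_of_int (s' ''r'' 0) = real_of_int d * real_of_rat (budget I) \<and>
    (\<forall>v\<in>nodes I. real_of_int (s' ''a'' (int v)) = real_of_int d * real_of_rat (val I v) \<and>
       real_of_int (s' ''b'' (int v)) = real_of_int d * real_of_rat (wgt I v))) s"
proof -
  let ?Inv = "\<lambda>j s'. real_of_int (s' ''r'' 0) = real_of_int d * real_of_rat (budget I) \<and>
    (\<forall>v\<in>nodes I. v < j \<longrightarrow> s' ''act'' (int v) = 1 \<and>
       real_of_int (s' ''a'' (int v)) = real_of_int d * real_of_rat (val I v) \<and>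
       real_of_int (s' ''b'' (int v)) = real_of_int d * real_of_rat (wgt I v))"
  let ?s = "s(''r'' := (s ''r'')(0 := inp 1 * (d div inp 2)))"
  let ?c = "Seq (Store ''a'' (reg ''i'') (Mul (field ''i'' (-1)) (Div (reg ''d'') (field ''i'' 0))))
       (Seq (Store ''b'' (reg ''i'') (Mul (field ''i'' 1) (Div (reg ''d'') (field ''i'' 2))))
         (Store ''act'' (reg ''i'') (Const 1)))"
  have "wp T (for_nodes ''i'' ?c) (\<lambda>s'. active s' (nodes I) \<and>
    real_of_int (s' ''r'' 0) = real_of_int d * real_of_rat (budget I) \<and>
    (\<forall>v\<in>nodes I. real_of_int (s' ''a'' (int v)) = real_of_int d * real_of_rat (val I v) \<and>
       real_of_int (s' ''b'' (int v)) = real_of_int d * real_of_rat (wgt I v))) ?s"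
  proof (rule wp_for_nodes[where I = ?Inv and n = n])
    show "?s ''in'' 0 = int n" using s by (simp add: inp_head)
    have "real_of_int (inp 1 * (d div inp 2)) = real_of_int d * real_of_rat (budget I)"
      using d(2) scaled_quotient[of "budget I" d] by (simp only: inp_head)
    then show "?Inv 1 (?s(''i'' := (?s ''i'')(0 := 1)))" by (auto simp: nodes_eq)
  next
    fix j s' assume j: "1 \<le> j" "j \<le> n" "s' ''i'' 0 = int j" "?Inv j s'"
      and fr: "\<And>Y. Y \<noteq> ''i'' \<Longrightarrow> Y \<notin> writes ?c \<Longrightarrow> s' Y = ?s Y"
    have jn: "j \<in> nodes I" using j by (simp add: nodes_eq)
    have banks: "s' ''in'' = inp" "s' ''d'' 0 = d" using s d by (auto simp: fr)
    have "real_of_int (inp (5 * int j - 1) * (d div inp (5 * int j))) = real_of_int d * real_of_rat (val I j)"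
      "real_of_int (inp (5 * int j + 1) * (d div inp (5 * int j + 2))) = real_of_int d * real_of_rat (wgt I j)"
      using d(3)[OF jn] scaled_quotient[of "val I j" d] scaled_quotient[of "wgt I j" d]
      by (simp_all only: inp_fields[OF jn])
    then show "wp T ?c (\<lambda>s''. ?Inv (Suc j) (s''(''i'' := (s'' ''i'')(0 := int (Suc j))))) s'"
      using j by (auto simp: field_def less_Suc_eq banks)
  qed (use n_le_T in \<open>auto simp: nodes_eq active_def\<close>)
  then show ?thesis using s d by (simp add: scale_def)
qed

section \<open>From the invariant to the approximation guarantee\<close>

lemma feasible_monotone_vec:
  assumes "tkp_feasible I x"
  shows "monotone_vec (nodes I) x"
  unfolding monotone_vec_def
proof (intro ballI impI)
  fix u w assume u: "u \<in> nodes I" and "anc u w"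
  from this(2) have "w \<in> nodes I \<and> x u \<le> x w"
    unfolding anc_def
  proof (induction rule: rtrancl_induct)
    case base
    then show ?case using u by simp
  next
    case (step y z)
    then have "x y \<le> x z" using assms by (auto simp: tkp_feasible_def child_def)
    then show ?case using step by (auto simp: arcs_iff)
  qed
  then show "x u \<le> x w" by simp
qed

lemma chain_value_le:
  assumes "C \<subseteq> nodes I" "chain C"
  shows "(\<Sum>v\<in>C. real_of_rat (val I v)) \<le> max_chain_value I"
proof -
  have "is_chain I C"
    using assms by (auto simp: is_chain_def chain_def descendant_def anc_def rtrancl_eq_or_trancl)
  then show ?thesis
    unfolding max_chain_value_def using chain_values_finite_nonempty(1)[OF inst]
    by (intro Max_ge) auto
qed

text \<open>With no active node left, the dual bound of the empty set limits the scaled value of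
  every feasible \<open>y\<close> by that of C plus that of S, and the factor \<open>d\<close>
  cancels. Feasibility comes from r \<ge> 0 and from S being closed under descendants.\<close>

lemma greedy_output:
  assumes inv: "greedy_inv a b (nodes I) B {} S r" and d: "0 < d"
    and a: "\<And>v. v \<in> nodes I \<Longrightarrow> a v = d * real_of_rat (val I v)"
    and b: "\<And>v. v \<in> nodes I \<Longrightarrow> b v = d * real_of_rat (wgt I v)"
    and B: "B = d * real_of_rat (budget I)"
    and x: "\<And>v. v \<in> nodes I \<Longrightarrow> x v = (if v \<in> S then 1 else 0)"
  shows "tkp_feasible I x" and "tkp_opt I - max_chain_value I \<le> tkp_objective I x"
proof -
  have S: "S \<subseteq> nodes I" "\<forall>u\<in>S. \<forall>w\<in>nodes I. anc u w \<longrightarrow> w \<in> S" "0 \<le> r" "sum b S + r = B"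
    using inv by (auto simp: greedy_inv_def)
  have indicator: "(\<Sum>v\<in>nodes I. f v * x v) = sum f S" for f
  proof -
    have "(\<Sum>v\<in>nodes I. f v * x v) = (\<Sum>v\<in>nodes I. if v \<in> S then f v else 0)"
      by (rule sum.cong) (auto simp: x)
    also have "\<dots> = sum f (nodes I \<inter> S)" using finite_nodes by (rule sum.inter_restrict[symmetric])
    finally show ?thesis using S(1) by (simp add: Int_absorb1)
  qed
  have val: "sum a C = d * (\<Sum>v\<in>C. real_of_rat (val I v))" if "C \<subseteq> nodes I" for C
    unfolding sum_distrib_left using that a by (intro sum.cong) auto
  have wgt: "sum b C = d * (\<Sum>v\<in>C. real_of_rat (wgt I v))" if "C \<subseteq> nodes I" for C
    unfolding sum_distrib_left using that b by (intro sum.cong) auto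
  have "d * (\<Sum>v\<in>S. real_of_rat (wgt I v)) \<le> d * real_of_rat (budget I)"
    using S wgt[OF S(1)] B by simp
  then have "(\<Sum>v\<in>S. real_of_rat (wgt I v)) \<le> real_of_rat (budget I)" using d by simp
  moreover have "x v \<le> x u" if "v \<in> nodes I" "u \<in> child I v" for u v
  proof -
    have "(v, u) \<in> arcs I" using that by (simp add: child_def)
    then have "anc v u" "u \<in> nodes I" by (auto simp: anc_def arcs_iff)
    then show ?thesis using S(2) that x by auto
  qed
  ultimately show "tkp_feasible I x"
    unfolding tkp_feasible_def indicator using x by auto
  obtain C where C: "C \<subseteq> nodes I" "chain C"
    and pot: "\<And>y. monotone_vec (nodes I) y \<Longrightarrow> \<forall>v\<in>nodes I. 0 \<le> y v \<and> y v \<le> 1 \<Longrightarrow>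
        (\<Sum>v\<in>nodes I. b v * y v) \<le> B \<Longrightarrow>
          potential a b {} r ((\<Sum>v\<in>nodes I. a v * y v) - sum a C - sum a S)"
    using inv unfolding greedy_inv_def by blast
  have "tkp_opt I \<le> tkp_objective I x + max_chain_value I"
    unfolding tkp_opt_def
  proof (rule cSup_least[OF tkp_values_nonempty_bdd(1)[OF inst]])
    fix z assume "z \<in> {tkp_objective I y | y. tkp_feasible I y}"
    then obtain y where y: "tkp_feasible I y" and z: "z = tkp_objective I y" by blast
    have "(\<Sum>v\<in>nodes I. b v * y v) = d * (\<Sum>v\<in>nodes I. real_of_rat (wgt I v) * y v)"
      unfolding sum_distrib_left using b by (intro sum.cong) auto
    also have "\<dots> \<le> B" unfolding B using y d by (intro mult_left_mono) (auto simp: tkp_feasible_def)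
    finally have "potential a b {} r ((\<Sum>v\<in>nodes I. a v * y v) - sum a C - sum a S)"
      using feasible_monotone_vec[OF y] y by (intro pot) (auto simp: tkp_feasible_def)
    then have "(\<Sum>v\<in>nodes I. a v * y v) - sum a C - sum a S \<le> 0" by (rule potential_empty)
    moreover have "(\<Sum>v\<in>nodes I. a v * y v) = d * z"
      unfolding z tkp_objective_def sum_distrib_left using a by (intro sum.cong) auto
    moreover have "sum a S = d * tkp_objective I x"
      unfolding tkp_objective_def indicator by (rule val[OF S(1)])
    ultimately have "d * z \<le> d * (tkp_objective I x + (\<Sum>v\<in>C. real_of_rat (val I v)))"
      using val[OF C(1)] by (simp add: algebra_simps)
    then have "z \<le> tkp_objective I x + (\<Sum>v\<in>C. real_of_rat (val I v))" using d by simp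
    then show "z \<le> tkp_objective I x + max_chain_value I"
      using chain_value_le[OF C] by simp
  qed
  then show "tkp_opt I - max_chain_value I \<le> tkp_objective I x" by simp
qed

lemma wp_tk_program:
  "wp T tk_program (\<lambda>s. tkp_feasible I (output_vector s) \<and>
     (\<forall>v\<in>nodes I. output_vector s v \<in> {0, 1}) \<and>
     tkp_objective I (output_vector s) \<ge> tkp_opt I - max_chain_value I) (init_memory (encode I))"
  (is "wp T tk_program ?Q ?s0")
proof -
  have s0: "?s0 ''in'' = inp" "\<And>w. ?s0 ''out'' w = 0" by (simp_all add: inp_def init_memory_def)
  have "wp T denominators (wp T scale (wp T (for_nodes ''k'' greedy_step) ?Q)) ?s0"
  proof (rule wp_consequence[OF wp_denominators[of ?s0, OF s0(1)]])
    fix s1 :: memory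
    let ?d = "s1 ''d'' 0"
    assume d: "0 < ?d \<and> inp 2 dvd ?d \<and>
       (\<forall>v\<in>nodes I. inp (5 * int v) dvd ?d \<and> inp (5 * int v + 2) dvd ?d)"
      and fr1: "\<And>X. X \<notin> writes denominators \<Longrightarrow> s1 X = ?s0 X"
    have s1: "s1 ''in'' = inp" "\<And>w. s1 ''out'' w = 0" using s0 by (simp_all add: fr1)
    show "wp T scale (wp T (for_nodes ''k'' greedy_step) ?Q) s1"
    proof (rule wp_consequence[OF wp_scale[of s1 ?d, OF s1(1) refl]])
      fix s2
      assume s2: "active s2 (nodes I) \<and>
        real_of_int (s2 ''r'' 0) = real_of_int ?d * real_of_rat (budget I) \<and>
        (\<forall>v\<in>nodes I. real_of_int (s2 ''a'' (int v)) = real_of_int ?d * real_of_rat (val I v) \<and>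
          real_of_int (s2 ''b'' (int v)) = real_of_int ?d * real_of_rat (wgt I v))"
        and fr2: "\<And>X. X \<notin> writes scale \<Longrightarrow> s2 X = s1 X"
      have nn: "0 \<le> val I v" "0 \<le> wgt I v" if "v \<in> nodes I" for v
        using inst that by (auto simp: tk_instance_def)
      have ab: "0 \<le> s2 ''a'' (int v)" "0 \<le> s2 ''b'' (int v)" if "v \<in> nodes I" for v
      proof -
        have "0 \<le> real_of_int (s2 ''a'' (int v))" "0 \<le> real_of_int (s2 ''b'' (int v))"
          using s2 d nn[OF that] that by auto
        then show "0 \<le> s2 ''a'' (int v)" "0 \<le> s2 ''b'' (int v)" by simp_all
      qed
      have "0 \<le> real_of_int (s2 ''r'' 0)" using s2 d inst by (auto simp: tk_instance_def)
      then have r: "0 \<le> s2 ''r'' 0" by simp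
      have "s2 ''in'' = inp" "\<And>w. s2 ''out'' w = 0" using s1 by (simp_all add: fr2)
      then show "wp T (for_nodes ''k'' greedy_step) ?Q s2"
      proof (intro wp_mono[OF wp_greedy_loop[of s2 "\<lambda>w. s2 ''a'' (int w)" "\<lambda>w. s2 ''b'' (int w)",
            OF _ _ refl refl ab _ r]])
        fix s3 assume "\<exists>S. (\<forall>w\<in>nodes I. s3 ''out'' (int w) = (if w \<in> S then 1 else 0 :: int)) \<and>
          greedy_inv (\<lambda>w. real_of_int (s2 ''a'' (int w))) (\<lambda>w. real_of_int (s2 ''b'' (int w)))
            (nodes I) (s2 ''r'' 0) {} S (s3 ''r'' 0)"
        then obtain S where out: "\<And>w. w \<in> nodes I \<Longrightarrow> s3 ''out'' (int w) = (if w \<in> S then 1 else 0 :: int)"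
          and inv: "greedy_inv (\<lambda>w. real_of_int (s2 ''a'' (int w)))
            (\<lambda>w. real_of_int (s2 ''b'' (int w))) (nodes I) (s2 ''r'' 0) {} S (s3 ''r'' 0)" by blast
        have x: "output_vector s3 v = (if v \<in> S then 1 else 0)" if "v \<in> nodes I" for v
          using out[OF that] by (simp add: output_vector_def)
        show "?Q s3"
          using greedy_output[OF inv, of "real_of_int ?d" "output_vector s3"] s2 d x by auto
      qed (use s2 in auto)
    qed (use d in auto)
  qed
  then show ?thesis by (simp only: tk_program_def wp.simps)
qed

end

theorem theorem3p1:
  shows "\<exists>(c :: com) (p :: nat poly).
    \<forall>I :: nat tree_knapsack. tk_instance I \<and> numbered I \<longrightarrow>
      (\<exists>t s. exec c (init_memory (encode I)) t s \<and>
             t \<le> poly p (input_size (encode I)) \<and>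
             tkp_feasible I (output_vector s) \<and>
             (\<forall>v\<in>nodes I. output_vector s v \<in> {0, 1}) \<and>
             tkp_objective I (output_vector s) \<ge> tkp_opt I - max_chain_value I)"
proof -
  obtain p :: "nat poly" where p: "\<And>xs Q. xs \<noteq> [] \<Longrightarrow>
      wp (input_size xs) tk_program Q (init_memory xs) \<Longrightarrow>
      \<exists>t s. exec tk_program (init_memory xs) t s \<and> t \<le> poly p (input_size xs) \<and> Q s"
    using wp_imp_poly_time[OF linear_stores_program] by blast
  have "\<exists>t s. exec tk_program (init_memory (encode I)) t s \<and>
             t \<le> poly p (input_size (encode I)) \<and>
             tkp_feasible I (output_vector s) \<and>
             (\<forall>v\<in>nodes I. output_vector s v \<in> {0, 1}) \<and>
             tkp_objective I (output_vector s) \<ge> tkp_opt I - max_chain_value I"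
    if I: "tk_instance I" "numbered I" for I
  proof (rule p)
    \<comment> \<open>The first interpretation supplies \<open>encode_length\<close>. It shows that
      the number of nodes is at most the input size, which admits the input size as iteration bound
      in the second one.\<close>
    interpret pre: knapsack_run I "card (nodes I)" using I by unfold_locales auto
    have "card (nodes I) \<le> length (encode I)" using pre.encode_length by (simp add: pre.n_def)
    then interpret knapsack_run I "input_size (encode I)"
      using I length_le_input_size[of "encode I"] by unfold_locales auto
    show "encode I \<noteq> []" by (simp add: encode_def)
    show "wp (input_size (encode I)) tk_program (\<lambda>s. tkp_feasible I (output_vector s) \<and>
       (\<forall>v\<in>nodes I. output_vector s v \<in> {0, 1}) \<and>
       tkp_objective I (output_vector s) \<ge> tkp_opt I - max_chain_value I) (init_memory (encode I))"
      by (rule wp_tk_program)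
  qed
  then show ?thesis by blast
qed

end
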